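(* Let $I=[a,b]\subset\mathbb{R}$ be a closed bounded interval ($a<b$), let $\varphi\in\Phi_{\mathrm c}$ (independent of $x$), let $K:=\lim_{t\to\infty}\frac{\varphi(t)}{t}\in(0,\infty]$, and let $f:I\to\mathbb{R}$ satisfy $\mathrm V^\varphi_I(f)<\infty$. (1) If $K<\infty$ and $f$ is left-continuous, then $f\in\mathrm{BV}(I)$ and $$\mathrm V^\varphi_I(f)=\int_I\varphi(|f'|)\,dx+K\,|D^sf|(I).$$ (2) If $K=\infty$, then $f$ is absolutely continuous and $\mathrm V^\varphi_I(f)=\int_I\varphi(|f'|)\,dx$.
   Context: $\Phi_{\mathrm c}$ is the set of functions $\varphi:[0,\infty)\to[0,\infty]$ that are non-decreasing, convex and left-continuous with $\varphi(0)=\lim_{t\to0^+}\varphi(t)=0$ and $\lim_{t\to\infty}\varphi(t)=\infty$. A partition $(I_k)_{k=1}^n$ of $I$ is a finite family of non-degenerate closed intervals with disjoint interiors and union $I$. For $I_k=[a_k,b_k]$, $\Delta_kf:=f(a_k)-f(b_k)$. For $\varphi\in\Phi_{\mathrm c}$, $$\mathrm V^\varphi_I(f):=\sup_{(I_k)}\sum_{k=1}^n\varphi\Big(\frac{|\Delta_kf|}{|I_k|}\Big)|I_k|,$$ the supremum being over all partitions of $I$. For a left-continuous function $f:[a,b]\to\mathbb{R}$ of bounded variation, $Df$ denotes the finite signed Borel measure on $I$ with $f(x)=f(a)+Df([a,x))$ for every $x\in I$ and $Df(\{b\})=0$ (so a jump of $f$ immediately to the right of $a$ is an atom of $Df$ at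 $a$). Its Lebesgue decomposition with respect to Lebesgue measure is $Df=f'\,dx+D^sf$, with $D^sf$ the singular part and $|D^sf|$ its total variation measure. *)

theory Defs
  imports "HOL-Analysis.Analysis"
begin

section \<open>The class of convex functions and the growth constant\<close>

text \<open>A function \<open>[0,\<infinity>) \<rightarrow> [0,\<infinity>]\<close> is represented by a function on the reals of which
  only the values at non-negative arguments are ever used.\<close>

definition Phi_c :: "(real \<Rightarrow> ennreal) \<Rightarrow> bool" where
  "Phi_c \<phi> \<longleftrightarrow>
     mono_on {0..} \<phi> \<and>
     (\<forall>x\<ge>0. \<forall>y\<ge>0. \<forall>u\<in>{0..1}.
        \<phi> ((1 - u) * x + u * y) \<le> ennreal (1 - u) * \<phi> x + ennreal u * \<phi> y) \<and>
     (\<forall>t>0. (\<phi> \<longlongrightarrow> \<phi> t) (at_left t)) \<and>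
     \<phi> 0 = 0 \<and>
     (\<phi> \<longlongrightarrow> 0) (at_right 0) \<and>
     (\<phi> \<longlongrightarrow> \<infinity>) at_top"

definition growth_const :: "(real \<Rightarrow> ennreal) \<Rightarrow> ennreal" where
  "growth_const \<phi> = Lim at_top (\<lambda>t. \<phi> t / ennreal t)"

text \<open>The limit defining the growth constant exists and is positive.\<close>

lemma Phi_c_quotient_mono:
  assumes "Phi_c \<phi>" "0 < s" "s \<le> t"
  shows "\<phi> s / ennreal s \<le> \<phi> t / ennreal t"
proof -
  have u: "s / t \<in> {0..1}" and t: "0 < t" using assms by auto
  have "\<phi> ((1 - s / t) * 0 + s / t * t) \<le> ennreal (1 - s / t) * \<phi> 0 + ennreal (s / t) * \<phi> t"
    using assms(1) u t unfolding Phi_c_def by (metis less_eq_real_def order_refl)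
  moreover have "\<phi> 0 = 0" using assms(1) by (simp add: Phi_c_def)
  ultimately have "\<phi> s \<le> ennreal (s / t) * \<phi> t" using t by simp
  then have "\<phi> s / ennreal s \<le> ennreal (s / t) * \<phi> t / ennreal s"
    by (rule divide_right_mono_ennreal)
  also have "\<dots> = (ennreal (s / t) * ennreal (1 / s)) * \<phi> t"
    using assms(2) by (simp add: divide_ennreal_def inverse_ennreal mult_ac inverse_eq_divide)
  also have "ennreal (s / t) * ennreal (1 / s) = ennreal (1 / t)"
    using assms(2) t by (simp flip: ennreal_mult)
  also have "ennreal (1 / t) * \<phi> t = \<phi> t / ennreal t"
    using t by (simp add: divide_ennreal_def inverse_ennreal mult_ac inverse_eq_divide)
  finally show ?thesis .
qed

lemma tendsto_growth_const:
  assumes "Phi_c \<phi>"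
  shows "((\<lambda>t. \<phi> t / ennreal t) \<longlongrightarrow> growth_const \<phi>) at_top"
proof -
  have "((\<lambda>t. \<phi> t / ennreal t) \<longlongrightarrow> (SUP t\<in>{0<..}. \<phi> t / ennreal t)) at_top"
  proof (rule increasing_tendsto)
    show "\<forall>\<^sub>F t in at_top. \<phi> t / ennreal t \<le> (SUP t\<in>{0<..}. \<phi> t / ennreal t)"
      using eventually_gt_at_top[of 0] by eventually_elim (auto intro: SUP_upper)
  next
    fix x assume "x < (SUP t\<in>{0<..}. \<phi> t / ennreal t)"
    then obtain s where s: "0 < s" "x < \<phi> s / ennreal s"
      by (auto simp: less_SUP_iff)
    show "\<forall>\<^sub>F t in at_top. x < \<phi> t / ennreal t"
      using eventually_ge_at_top[of s]
      by eventually_elim (use s Phi_c_quotient_mono[OF assms s(1)] in \<open>auto intro: less_le_trans\<close>)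
  qed
  then show ?thesis
    unfolding growth_const_def by (subst tendsto_Lim) auto
qed

lemma growth_const_pos:
  assumes "Phi_c \<phi>"
  shows "0 < growth_const \<phi>"
proof -
  have "(\<phi> \<longlongrightarrow> \<infinity>) at_top" using assms by (simp add: Phi_c_def)
  then have "\<forall>\<^sub>F t in at_top. 0 < \<phi> t" by (rule order_tendstoD) simp
  then have "\<forall>\<^sub>F t in at_top. 0 < \<phi> t \<and> 0 < t"
    using eventually_gt_at_top[of "0::real"] by eventually_elim simp
  then obtain s where s: "0 < \<phi> s" "0 < s"
    by (auto dest: eventually_happens)
  have "0 < \<phi> s / ennreal s" using s by (simp add: ennreal_zero_less_divide)
  also have "\<phi> s / ennreal s \<le> growth_const \<phi>"
  proof (rule tendsto_lowerbound[OF tendsto_growth_const[OF assms]])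
    show "\<forall>\<^sub>F t in at_top. \<phi> s / ennreal s \<le> \<phi> t / ennreal t"
      using eventually_ge_at_top[of s]
      by eventually_elim (rule Phi_c_quotient_mono[OF assms s(2)])
  qed simp
  finally show ?thesis .
qed


section \<open>Variation and absolute continuity\<close>

definition partitions :: "real \<Rightarrow> real \<Rightarrow> real set set set" where
  "partitions a b = {P. P division_of {a..b} \<and> (\<forall>J\<in>P. interior J \<noteq> {})}"

text \<open>For \<open>J = {c..d}\<close> with \<open>c \<le> d\<close> we have \<open>Inf J = c\<close>, \<open>Sup J = d\<close> and
  \<open>measure lborel J = d - c\<close>.\<close>

definition phi_variation :: "(real \<Rightarrow> ennreal) \<Rightarrow> real \<Rightarrow> real \<Rightarrow> (real \<Rightarrow> real) \<Rightarrow> ennreal" where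
  "phi_variation \<phi> a b f =
     (SUP P\<in>partitions a b.
        \<Sum>J\<in>P. \<phi> (\<bar>f (Inf J) - f (Sup J)\<bar> / measure lborel J) * ennreal (measure lborel J))"

definition bounded_variation_on :: "real \<Rightarrow> real \<Rightarrow> (real \<Rightarrow> real) \<Rightarrow> bool" where
  "bounded_variation_on a b f \<longleftrightarrow>
     (\<exists>M. \<forall>P\<in>partitions a b. (\<Sum>J\<in>P. \<bar>f (Inf J) - f (Sup J)\<bar>) \<le> M)"

text \<open>\<open>P division_of \<Union>P\<close> says that \<open>P\<close> is a finite family of non-overlapping compact
  intervals.\<close>

definition absolutely_continuous_on :: "real \<Rightarrow> real \<Rightarrow> (real \<Rightarrow> real) \<Rightarrow> bool" where
  "absolutely_continuous_on a b f \<longleftrightarrow>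
     (\<forall>\<epsilon>>0. \<exists>\<delta>>0. \<forall>P. P division_of \<Union>P \<and> \<Union>P \<subseteq> {a..b} \<and> (\<Sum>J\<in>P. measure lborel J) < \<delta> \<longrightarrow>
        (\<Sum>J\<in>P. \<bar>f (Inf J) - f (Sup J)\<bar>) < \<epsilon>)"

definition left_continuous_on :: "real \<Rightarrow> real \<Rightarrow> (real \<Rightarrow> real) \<Rightarrow> bool" where
  "left_continuous_on a b f \<longleftrightarrow> (\<forall>x\<in>{a<..b}. (f \<longlongrightarrow> f x) (at_left x))"


section \<open>Signed measures and the derivative measure\<close>

text \<open>A finite signed measure on the measurable space of \<open>M\<close> is a set function of which only the
  values on \<open>sets M\<close> matter. The measure carried by \<open>M\<close> itself plays no role.\<close>

definition finite_signed_measure :: "'a measure \<Rightarrow> ('a set \<Rightarrow> real) \<Rightarrow> bool" where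
  "finite_signed_measure M \<mu> \<longleftrightarrow>
     \<mu> {} = 0 \<and>
     (\<forall>A :: nat \<Rightarrow> 'a set. range A \<subseteq> sets M \<and> disjoint_family A \<longrightarrow>
        (\<lambda>n. \<mu> (A n)) sums \<mu> (\<Union>n. A n))"

definition total_variation :: "'a measure \<Rightarrow> ('a set \<Rightarrow> real) \<Rightarrow> 'a set \<Rightarrow> ennreal" where
  "total_variation M \<mu> A =
     (SUP E\<in>{E :: nat \<Rightarrow> 'a set. range E \<subseteq> sets M \<and> disjoint_family E \<and> (\<Union>n. E n) = A}.
        \<Sum>n. ennreal \<bar>\<mu> (E n)\<bar>)"

abbreviation borel_Icc :: "real \<Rightarrow> real \<Rightarrow> real measure" where
  "borel_Icc a b \<equiv> restrict_space borel {a..b}"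

definition is_deriv_measure :: "real \<Rightarrow> real \<Rightarrow> (real \<Rightarrow> real) \<Rightarrow> (real set \<Rightarrow> real) \<Rightarrow> bool" where
  "is_deriv_measure a b f \<mu> \<longleftrightarrow>
     finite_signed_measure (borel_Icc a b) \<mu> \<and>
     (\<forall>x\<in>{a..b}. f x = f a + \<mu> {a..<x}) \<and> \<mu> {b} = 0"

text \<open>For left-continuous \<open>f\<close> of bounded variation such a measure exists, and its values on
  the Borel subsets of \<open>{a..b}\<close> are uniquely determined.\<close>

definition deriv_measure :: "real \<Rightarrow> real \<Rightarrow> (real \<Rightarrow> real) \<Rightarrow> real set \<Rightarrow> real" where
  "deriv_measure a b f = (SOME \<mu>. is_deriv_measure a b f \<mu>)"

definition is_lebesgue_decomposition ::
    "real \<Rightarrow> real \<Rightarrow> (real set \<Rightarrow> real) \<Rightarrow> (real \<Rightarrow> real) \<Rightarrow> (real set \<Rightarrow> real) \<Rightarrow> bool" where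
  "is_lebesgue_decomposition a b \<mu> g \<nu> \<longleftrightarrow>
     set_integrable lborel {a..b} g \<and>
     finite_signed_measure (borel_Icc a b) \<nu> \<and>
     (\<exists>N\<in>sets (borel_Icc a b). emeasure lborel N = 0 \<and>
        (\<forall>A\<in>sets (borel_Icc a b). A \<inter> N = {} \<longrightarrow> \<nu> A = 0)) \<and>
     (\<forall>A\<in>sets (borel_Icc a b). \<mu> A = (LINT x:A|lborel. g x) + \<nu> A)"

text \<open>The two parts \<open>f'\<close> and \<open>D\<^sup>s f\<close> of the Lebesgue decomposition of the derivative measure.
  The density is determined up to Lebesgue null sets, and the singular part is determined on
  the Borel subsets of \<open>{a..b}\<close>.\<close>

definition ac_density :: "real \<Rightarrow> real \<Rightarrow> (real \<Rightarrow> real) \<Rightarrow> real \<Rightarrow> real" where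
  "ac_density a b f =
     (SOME g. \<exists>\<nu>. is_lebesgue_decomposition a b (deriv_measure a b f) g \<nu>)"

definition singular_part :: "real \<Rightarrow> real \<Rightarrow> (real \<Rightarrow> real) \<Rightarrow> real set \<Rightarrow> real" where
  "singular_part a b f =
     (SOME \<nu>. \<exists>g. is_lebesgue_decomposition a b (deriv_measure a b f) g \<nu>)"

end

theory Submission
  imports Defs
begin

text \<open>Everything rests on affine minorants \<open>s \<mapsto> \<alpha> * s - \<beta>\<close> of \<open>\<phi>\<close>: \<open>\<phi>\<close> is the supremum of countably
  many of them, and the supremum of their slopes is the growth constant.

  For the upper bound, each minorant satisfies
  \<open>\<alpha> * \<bar>Df J\<bar> - \<beta> * \<bar>J\<bar> \<le> (\<integral>x\<in>J. \<alpha> * \<bar>f' x\<bar> - \<beta>) + \<alpha> * \<bar>D\<^sup>s f J\<bar>\<close> on an interval \<open>J\<close>; take suprema and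
  sum over a partition.

  For the lower bound, let \<open>F x\<close> be the \<open>\<phi>\<close>-variation of \<open>f\<close> on \<open>[a, x]\<close>. Superadditivity makes
  \<open>F - \<alpha> * \<sigma> * f + \<beta> * x\<close> non-decreasing for every minorant and every \<open>\<bar>\<sigma>\<bar> \<le> 1\<close>, so the Stieltjes measure \<open>L\<close>
  of the left limits of \<open>F\<close> dominates \<open>\<alpha> * \<sigma> * Df - \<beta> dx\<close> on all Borel sets, not only on intervals. Hence
  the density of \<open>L\<close> is at least \<open>\<phi> \<bar>f'\<bar>\<close> almost everywhere, and on a Lebesgue null set carrying \<open>D\<^sup>s f\<close>
  the mass of \<open>L\<close> is at least \<open>\<alpha> * \<bar>D\<^sup>s f\<bar>\<close>; no differentiation theorem is needed. The same monotonicity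
  exhibits \<open>f\<close> as a difference of monotone functions and so produces \<open>Df\<close>.

  If the growth constant is infinite, finiteness of the variation forces the singular term to
  vanish.\<close>

section \<open>Affine minorants\<close>

definition affine_minorant :: "(real \<Rightarrow> ennreal) \<Rightarrow> real \<Rightarrow> real \<Rightarrow> bool" where
  "affine_minorant \<phi> \<alpha> \<beta> \<longleftrightarrow> 0 \<le> \<alpha> \<and> 0 \<le> \<beta> \<and> (\<forall>s\<ge>0. ennreal (\<alpha> * s - \<beta>) \<le> \<phi> s)"

lemma Phi_c_mono: "Phi_c \<phi> \<Longrightarrow> 0 \<le> s \<Longrightarrow> s \<le> t \<Longrightarrow> \<phi> s \<le> \<phi> t"
  unfolding Phi_c_def by (meson atLeast_iff mono_onD order_trans)

lemma Phi_c_three_points: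
  assumes "Phi_c \<phi>" "0 \<le> p" "p < s" "s < q" and "\<phi> q < \<infinity>"
  shows "(enn2real (\<phi> s) - enn2real (\<phi> p)) / (s - p) \<le> (enn2real (\<phi> q) - enn2real (\<phi> s)) / (q - s)"
proof -
  define u where "u = (s - p) / (q - p)"
  have u: "u \<in> {0..1}" using assms by (auto simp: u_def)
  have *: "(1 - u) * p + u * q = s"
    using assms by (simp add: u_def divide_simps) (simp add: algebra_simps)
  have fin: "\<phi> s < \<infinity>" "\<phi> p < \<infinity>"
    using Phi_c_mono[OF assms(1), of s q] Phi_c_mono[OF assms(1), of p q] assms
    by (auto intro: le_less_trans)
  have "\<phi> ((1 - u) * p + u * q) \<le> ennreal (1 - u) * \<phi> p + ennreal u * \<phi> q"
    using assms(1,2,3,4) u unfolding Phi_c_def by (meson less_eq_real_def order_trans)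
  then have "ennreal (enn2real (\<phi> s)) \<le> ennreal (1 - u) * ennreal (enn2real (\<phi> p)) + ennreal u * ennreal (enn2real (\<phi> q))"
    using fin assms(5) * by (simp add: ennreal_enn2real)
  also have "\<dots> = ennreal ((1 - u) * enn2real (\<phi> p) + u * enn2real (\<phi> q))"
    using u by (simp add: ennreal_mult ennreal_plus)
  finally have "enn2real (\<phi> s) \<le> (1 - u) * enn2real (\<phi> p) + u * enn2real (\<phi> q)"
    using u by (subst (asm) ennreal_le_iff) auto
  then have "(q - p) * enn2real (\<phi> s) \<le> (q - p) * ((1 - u) * enn2real (\<phi> p) + u * enn2real (\<phi> q))"
    using assms by (intro mult_left_mono) auto
  also have "\<dots> = (q - s) * enn2real (\<phi> p) + (s - p) * enn2real (\<phi> q)"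
  proof -
    have "(q - p) * (1 - u) = q - s" "(q - p) * u = s - p"
      using assms by (simp_all add: u_def field_simps)
    then show ?thesis by (metis (no_types) distrib_left mult.assoc)
  qed
  finally show ?thesis using assms by (simp add: divide_simps) (simp add: algebra_simps)
qed

lemma supporting_line:
  assumes "Phi_c \<phi>" "0 < s" "s < u" "\<phi> u < \<infinity>"
  obtains \<alpha> \<beta> where "affine_minorant \<phi> \<alpha> \<beta>" "ennreal (\<alpha> * s - \<beta>) = \<phi> s"
proof -
  define \<psi> where "\<psi> = (\<lambda>s. enn2real (\<phi> s))"
  have fin: "\<phi> p < \<infinity>" if "0 \<le> p" "p \<le> u" for p
    using Phi_c_mono[OF assms(1) that] assms(4) by (auto intro: le_less_trans)
  define m where "m = (SUP p\<in>{0..<s}. (\<psi> s - \<psi> p) / (s - p))"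
  have sl: "(\<psi> s - \<psi> p) / (s - p) \<le> (\<psi> q - \<psi> s) / (q - s)" if "0 \<le> p" "p < s" "s < q" "\<phi> q < \<infinity>" for p q
    using Phi_c_three_points[OF assms(1) that] by (simp add: \<psi>_def)
  have "bdd_above ((\<lambda>p. (\<psi> s - \<psi> p) / (s - p)) ` {0..<s})"
    using sl[OF _ _ assms(3,4)] by (intro bdd_aboveI2) auto
  then have up: "(\<psi> s - \<psi> p) / (s - p) \<le> m" if "0 \<le> p" "p < s" for p
    using that unfolding m_def by (intro cSUP_upper) auto
  have lo: "m \<le> (\<psi> q - \<psi> s) / (q - s)" if "s < q" "\<phi> q < \<infinity>" for q
    using sl[OF _ _ that] assms(2) unfolding m_def by (intro cSUP_least) auto
  have "\<psi> 0 = 0" using assms(1) by (simp add: \<psi>_def Phi_c_def)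
  then have 1: "\<psi> s \<le> m * s" using up[of 0] assms(2) by (simp add: field_simps)
  then have m0: "0 \<le> m" using assms(2) enn2real_nonneg[of "\<phi> s"]
    by (metis \<psi>_def mult_less_0_iff not_less order_trans)
  have below: "ennreal (m * q - (m * s - \<psi> s)) \<le> \<phi> q" if "0 \<le> q" for q
  proof (cases "\<phi> q < \<infinity>")
    case True
    have "m * q - (m * s - \<psi> s) \<le> \<psi> q"
      using up[of q] lo[of q] that True
      by (cases q s rule: linorder_cases) (auto simp: field_simps)
    then show ?thesis using True unfolding \<psi>_def by (metis enn2real_nonneg ennreal_enn2real ennreal_leI infinity_ennreal_def)
  next
    case False
    then show ?thesis by (simp add: less_top[symmetric])
  qed
  have "affine_minorant \<phi> m (m * s - \<psi> s)"
    using m0 1 below by (auto simp: affine_minorant_def)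
  moreover have "ennreal (m * s - (m * s - \<psi> s)) = \<phi> s"
    using fin[of s] assms by (simp add: \<psi>_def)
  ultimately show ?thesis using that by blast
qed

lemma affine_minorant_shrink:
  assumes "affine_minorant \<phi> \<alpha> \<beta>" "0 \<le> \<alpha>'" "\<alpha>' \<le> \<alpha>" "\<beta> \<le> \<beta>'"
  shows "affine_minorant \<phi> \<alpha>' \<beta>'"
proof -
  have "ennreal (\<alpha>' * s - \<beta>') \<le> \<phi> s" if "0 \<le> s" for s
  proof -
    have "\<alpha>' * s - \<beta>' \<le> \<alpha> * s - \<beta>"
      using assms that by (intro diff_mono mult_right_mono) auto
    then show ?thesis
      using assms(1) that unfolding affine_minorant_def by (meson ennreal_leI order_trans)
  qed
  then show ?thesis using assms by (auto simp: affine_minorant_def)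
qed

lemma ex_affine_minorant:
  assumes \<phi>: "Phi_c \<phi>" and t: "0 \<le> t" and y: "y < \<phi> t"
  obtains \<alpha> \<beta> where "\<alpha> \<in> \<rat>" "\<beta> \<in> \<rat>" "affine_minorant \<phi> \<alpha> \<beta>" "y < ennreal (\<alpha> * t - \<beta>)"
proof -
  have t0: "0 < t" using \<phi> t y by (cases "t = 0") (auto simp: Phi_c_def)
  have "\<exists>\<alpha> \<beta>. affine_minorant \<phi> \<alpha> \<beta> \<and> y < ennreal (\<alpha> * t - \<beta>)"
  proof (cases "\<exists>u. 0 \<le> u \<and> u < t \<and> \<phi> u = \<infinity>")
    case True
    then obtain u where u: "0 \<le> u" "u < t" "\<phi> u = \<infinity>" by blast
    define \<alpha> where "\<alpha> = (enn2real y + 1) / (t - u)"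
    have \<alpha>0: "0 \<le> \<alpha>" using u by (simp add: \<alpha>_def add_nonneg_nonneg)
    have "ennreal (\<alpha> * s - \<alpha> * u) \<le> \<phi> s" if "0 \<le> s" for s
    proof (cases "s \<le> u")
      case True
      then have "\<alpha> * s - \<alpha> * u \<le> 0" using \<alpha>0 by (simp add: mult_left_mono)
      then show ?thesis by (simp add: ennreal_neg)
    next
      case False
      then have "\<phi> s = \<infinity>" using Phi_c_mono[OF \<phi>, of u s] u by (simp add: top_unique)
      then show ?thesis by simp
    qed
    then have "affine_minorant \<phi> \<alpha> (\<alpha> * u)"
      using \<alpha>0 u by (auto simp: affine_minorant_def)
    moreover have "\<alpha> * (t - u) = enn2real y + 1" using u by (simp add: \<alpha>_def)
    then have "\<alpha> * t - \<alpha> * u = enn2real y + 1" by (simp add: right_diff_distrib)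
    then have "y < ennreal (\<alpha> * t - \<alpha> * u)"
      using y by (cases y rule: ennreal_cases) (auto simp: ennreal_less_iff)
    ultimately show ?thesis by blast
  next
    case False
    have "(\<phi> \<longlongrightarrow> \<phi> t) (at_left t)" using \<phi> t0 by (simp add: Phi_c_def)
    then have "\<forall>\<^sub>F s in at_left t. y < \<phi> s" using y by (rule order_tendstoD)
    moreover have "\<forall>\<^sub>F s in at_left t. s \<in> {0<..<t}" using t0 by (rule eventually_at_leftI[rotated]) auto
    ultimately have "\<forall>\<^sub>F s in at_left t. y < \<phi> s \<and> s \<in> {0<..<t}" by (rule eventually_conj)
    then obtain s where s: "y < \<phi> s" "0 < s" "s < t"
      using eventually_happens'[of "at_left t"] by (auto simp: trivial_limit_at_left_real)
    have "\<phi> ((s + t) / 2) < \<infinity>" using False s t0 by (auto simp: less_top)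
    then obtain \<alpha> \<beta> where ab: "affine_minorant \<phi> \<alpha> \<beta>" "ennreal (\<alpha> * s - \<beta>) = \<phi> s"
      using supporting_line[OF \<phi> s(2), of "(s + t) / 2"] s by auto
    have "\<alpha> * s - \<beta> \<le> \<alpha> * t - \<beta>" using ab(1) s by (simp add: affine_minorant_def mult_left_mono)
    then have "y < ennreal (\<alpha> * t - \<beta>)" using s(1) ab(2) by (metis ennreal_leI less_le_trans)
    then show ?thesis using ab by blast
  qed
  then obtain \<alpha> \<beta> where ab: "affine_minorant \<phi> \<alpha> \<beta>" "y < ennreal (\<alpha> * t - \<beta>)" by blast
  define z where "z = enn2real y"
  have yz: "y = ennreal z" "0 \<le> z"
    using order_less_trans[OF ab(2) ennreal_less_top] unfolding z_def by (simp_all del: ennreal_less_top)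
  then have z: "z < \<alpha> * t - \<beta>" using ab(2) by (simp add: ennreal_less_iff)
  define \<delta> where "\<delta> = (\<alpha> * t - \<beta> - z) / 2"
  have \<delta>: "0 < \<delta>" using z by (simp add: \<delta>_def)
  have "0 < \<alpha> * t" using z yz(2) ab(1) by (auto simp: affine_minorant_def)
  then have "0 < \<alpha>" using t0 zero_less_mult_pos2 by blast
  then have "max 0 (\<alpha> - \<delta> / t) < \<alpha>" using \<delta> t0 by auto
  then obtain \<alpha>' where a': "\<alpha>' \<in> \<rat>" "max 0 (\<alpha> - \<delta> / t) < \<alpha>'" "\<alpha>' < \<alpha>"
    using Rats_dense_in_real by blast
  obtain \<beta>' where b': "\<beta>' \<in> \<rat>" "\<beta> < \<beta>'" "\<beta>' < \<beta> + \<delta>"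
    using Rats_dense_in_real[of \<beta> "\<beta> + \<delta>"] \<delta> by auto
  have "affine_minorant \<phi> \<alpha>' \<beta>'"
    using affine_minorant_shrink[OF ab(1), of \<alpha>' \<beta>'] a' b' by auto
  moreover have "\<alpha> * t - \<delta> < \<alpha>' * t"
    using a' t0 by (auto simp: field_simps)
  then have "z < \<alpha>' * t - \<beta>'" using b' by (simp add: \<delta>_def field_simps)
  then have "y < ennreal (\<alpha>' * t - \<beta>')" using yz by (simp add: ennreal_less_iff)
  ultimately show ?thesis using that a' b' by blast
qed

lemma growth_const_upper:
  assumes "Phi_c \<phi>" "0 < t"
  shows "\<phi> t \<le> growth_const \<phi> * ennreal t"
proof -
  have "\<phi> t / ennreal t \<le> growth_const \<phi>"
  proof (rule tendsto_lowerbound[OF tendsto_growth_const[OF assms(1)]])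
    show "\<forall>\<^sub>F s in at_top. \<phi> t / ennreal t \<le> \<phi> s / ennreal s"
      using eventually_ge_at_top[of t]
      by eventually_elim (rule Phi_c_quotient_mono[OF assms])
  qed simp
  then have "\<phi> t / ennreal t * ennreal t \<le> growth_const \<phi> * ennreal t"
    by (rule mult_right_mono) simp
  moreover have "\<phi> t / ennreal t * ennreal t = \<phi> t"
    using assms(2) by (simp add: divide_ennreal_def inverse_ennreal mult.assoc flip: ennreal_mult)
  ultimately show ?thesis by simp
qed

lemma affine_minorant_slope_le:
  assumes "Phi_c \<phi>" "affine_minorant \<phi> \<alpha> \<beta>"
  shows "ennreal \<alpha> \<le> growth_const \<phi>"
proof (cases "growth_const \<phi>")
  case (real K)
  have "\<alpha> \<le> K"
  proof (rule ccontr)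
    assume n: "\<not> \<alpha> \<le> K"
    define t where "t = (\<beta> + 1) / (\<alpha> - K)"
    have b: "0 \<le> \<beta>" using assms(2) by (simp add: affine_minorant_def)
    have t: "0 < t" using n b by (auto simp: t_def intro!: divide_pos_pos)
    have "ennreal (\<alpha> * t - \<beta>) \<le> ennreal (K * t)"
      using growth_const_upper[OF assms(1) t] assms(2) t real
      unfolding affine_minorant_def by (metis ennreal_mult'' less_eq_real_def order_trans)
    then have "\<alpha> * t - \<beta> \<le> K * t" using real t by (subst (asm) ennreal_le_iff) auto
    moreover have "(\<alpha> - K) * t = \<beta> + 1" using n by (simp add: t_def)
    ultimately show False by (simp add: algebra_simps)
  qed
  then show ?thesis using real by (simp add: ennreal_leI)
qed simp

lemma ex_affine_minorant_slope:
  assumes "Phi_c \<phi>" "y < growth_const \<phi>"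
  obtains \<alpha> \<beta> where "affine_minorant \<phi> \<alpha> \<beta>" "y < ennreal \<alpha>"
proof -
  have "\<forall>\<^sub>F t in at_top. y < \<phi> t / ennreal t \<and> 0 < t"
    using order_tendstoD(1)[OF tendsto_growth_const[OF assms(1)] assms(2)] eventually_gt_at_top[of "0::real"]
    by (rule eventually_conj)
  then obtain t where t: "y < \<phi> t / ennreal t" "0 < t" by (auto dest: eventually_happens)
  have "\<not> \<phi> t \<le> y * ennreal t"
    using t by (metis divide_le_posI_ennreal ennreal_zero_less_divide ennreal_less_zero_iff mult.commute not_le)
  then have "y * ennreal t < \<phi> t" by simp
  then obtain \<alpha> \<beta> where ab: "affine_minorant \<phi> \<alpha> \<beta>" "y * ennreal t < ennreal (\<alpha> * t - \<beta>)"
    using ex_affine_minorant[OF assms(1), of t "y * ennreal t"] t(2) by (metis less_eq_real_def)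
  have "ennreal (\<alpha> * t - \<beta>) \<le> ennreal \<alpha> * ennreal t"
    using ab(1) t(2) by (subst ennreal_mult'[symmetric]) (auto simp: affine_minorant_def intro!: ennreal_leI)
  then have "\<not> ennreal \<alpha> \<le> y"
    using ab(2) by (metis mult_right_mono not_less order_trans zero_le)
  then show ?thesis using ab(1) that by simp
qed

section \<open>The variation function\<close>

definition phi_sum :: "(real \<Rightarrow> ennreal) \<Rightarrow> (real \<Rightarrow> real) \<Rightarrow> real set set \<Rightarrow> ennreal" where
  "phi_sum \<phi> f P =
     (\<Sum>J\<in>P. \<phi> (\<bar>f (Inf J) - f (Sup J)\<bar> / measure lborel J) * ennreal (measure lborel J))"

text \<open>These families need not cover \<open>{a..b}\<close> and may contain degenerate intervals, on which
  \<^const>\<open>phi_sum\<close> vanishes because of the factor \<open>measure lborel J\<close>.\<close>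

definition subdivisions :: "real \<Rightarrow> real \<Rightarrow> real set set set" where
  "subdivisions a b = {P. P division_of \<Union>P \<and> \<Union>P \<subseteq> {a..b}}"

lemma subdivisions_D:
  assumes "P \<in> subdivisions a b" "J \<in> P"
  obtains c d where "J = {c..d}" "c \<le> d" "a \<le> c" "d \<le> b" "measure lborel J = d - c"
    "Inf J = c" "Sup J = d"
proof -
  have "P division_of \<Union>P" using assms(1) by (simp add: subdivisions_def)
  then obtain c d where "J = cbox c d" "J \<noteq> {}" using assms(2) by (metis division_ofD(3,4))
  moreover have "J \<subseteq> {a..b}" using assms by (auto simp: subdivisions_def)
  ultimately show ?thesis by (intro that[of c d]) auto
qed

lemma finite_subdivisions: "P \<in> subdivisions a b \<Longrightarrow> finite P"
  by (auto simp: subdivisions_def dest: division_of_finite)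

lemma partitions_subset_subdivisions: "partitions a b \<subseteq> subdivisions a b"
  by (auto simp: partitions_def subdivisions_def dest: division_ofD(6))

lemma phi_sum_le_variation:
  assumes ab: "a < b" and P: "P \<in> subdivisions a b"
  shows "phi_sum \<phi> f P \<le> phi_variation \<phi> a b f"
proof -
  have "P division_of \<Union>P" "\<Union>P \<subseteq> cbox a b" using P by (auto simp: subdivisions_def)
  then obtain Q where Q: "P \<subseteq> Q" "Q division_of cbox a b"
    by (rule partial_division_extend_interval)
  define R where "R = {k. k \<in> Q \<and> measure lborel k \<noteq> 0}"
  have R: "R division_of cbox a b"
    using division_of_nontrivial[OF Q(2)] ab unfolding R_def by simp
  have "interior J \<noteq> {}" if "J \<in> R" for J
  proof -
    obtain c d where "J = cbox c d" using division_ofD(4)[OF R \<open>J \<in> R\<close>] by blast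
    moreover have "measure lborel J \<noteq> 0" using that by (simp add: R_def)
    ultimately show ?thesis by (auto simp: interior_cbox split: if_splits)
  qed
  then have Rp: "R \<in> partitions a b" using R by (simp add: partitions_def)
  have "phi_sum \<phi> f P \<le> phi_sum \<phi> f Q"
    unfolding phi_sum_def by (rule sum_mono2) (use Q in \<open>auto dest: division_of_finite\<close>)
  also have "\<dots> = phi_sum \<phi> f R"
    unfolding phi_sum_def by (rule sum.mono_neutral_right)
      (use Q in \<open>auto simp: R_def dest: division_of_finite\<close>)
  also have "\<dots> \<le> phi_variation \<phi> a b f"
    unfolding phi_variation_def phi_sum_def by (rule SUP_upper[OF Rp])
  finally show ?thesis .
qed

lemma measure_subdivisions_le:
  assumes "a \<le> b" "P \<in> subdivisions a b"
  shows "(\<Sum>J\<in>P. measure lborel J) \<le> b - a"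
proof -
  have P: "P division_of \<Union>P" "\<Union>P \<subseteq> cbox a b" using assms(2) by (auto simp: subdivisions_def)
  obtain Q where Q: "P \<subseteq> Q" "Q division_of cbox a b"
    using partial_division_extend_interval[OF P] .
  have "(\<Sum>J\<in>P. measure lborel J) \<le> (\<Sum>J\<in>Q. measure lborel J)"
    by (rule sum_mono2) (use Q in \<open>auto dest: division_of_finite\<close>)
  also have "\<dots> = b - a" using additive_content_division[OF Q(2)] assms(1) by simp
  finally show ?thesis .
qed

lemma ennreal_add_le: "ennreal (x + y) \<le> ennreal x + ennreal y"
  by (cases "0 \<le> x"; cases "0 \<le> y") (auto simp: ennreal_neg simp flip: ennreal_plus intro!: ennreal_leI)

lemma affine_minorant_increment:
  assumes "affine_minorant \<phi> \<alpha> \<beta>" "\<bar>\<sigma>\<bar> \<le> 1" "c < d"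
  shows "ennreal (\<alpha> * \<sigma> * (f d - f c) - \<beta> * (d - c)) \<le> \<phi> (\<bar>f c - f d\<bar> / (d - c)) * ennreal (d - c)"
proof -
  have "\<sigma> * (f d - f c) \<le> \<bar>\<sigma>\<bar> * \<bar>f c - f d\<bar>"
    by (metis abs_ge_self abs_minus_commute abs_mult)
  also have "\<dots> \<le> 1 * \<bar>f c - f d\<bar>" using assms(2) by (rule mult_right_mono) simp
  finally have "\<alpha> * (\<sigma> * (f d - f c)) \<le> \<alpha> * \<bar>f c - f d\<bar>"
    using assms(1) by (intro mult_left_mono) (auto simp: affine_minorant_def)
  then have "\<alpha> * \<sigma> * (f d - f c) - \<beta> * (d - c) \<le> (\<alpha> * (\<bar>f c - f d\<bar> / (d - c)) - \<beta>) * (d - c)"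
    using assms(3) by (simp add: left_diff_distrib mult.assoc)
  then have "ennreal (\<alpha> * \<sigma> * (f d - f c) - \<beta> * (d - c)) \<le> ennreal (\<alpha> * (\<bar>f c - f d\<bar> / (d - c)) - \<beta>) * ennreal (d - c)"
    using assms(3) by (subst ennreal_mult''[symmetric]) (auto intro: ennreal_leI)
  also have "\<dots> \<le> \<phi> (\<bar>f c - f d\<bar> / (d - c)) * ennreal (d - c)"
    using assms(1,3) unfolding affine_minorant_def by (intro mult_right_mono) (metis abs_ge_zero diff_ge_0_iff_ge
      divide_nonneg_nonneg less_eq_real_def, simp)
  finally show ?thesis .
qed

lemma sum_abs_increments_le:
  assumes ab: "a < b" and P: "P \<in> subdivisions a b" and V: "phi_variation \<phi> a b f < \<infinity>"
    and m: "affine_minorant \<phi> \<alpha> \<beta>"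
  shows "\<alpha> * (\<Sum>J\<in>P. \<bar>f (Inf J) - f (Sup J)\<bar>) \<le>
      enn2real (phi_variation \<phi> a b f) + \<beta> * (\<Sum>J\<in>P. measure lborel J)"
proof -
  let ?d = "\<lambda>J. \<bar>f (Inf J) - f (Sup J)\<bar>"
  let ?m = "measure lborel :: real set \<Rightarrow> real"
  have "ennreal (\<Sum>J\<in>P. \<alpha> * ?d J - \<beta> * ?m J) \<le> (\<Sum>J\<in>P. ennreal (\<alpha> * ?d J - \<beta> * ?m J))"
    using finite_subdivisions[OF P]
  proof (induction rule: finite_induct)
    case (insert J F)
    have "ennreal (\<Sum>J\<in>insert J F. \<alpha> * ?d J - \<beta> * ?m J) \<le>
       ennreal (\<alpha> * ?d J - \<beta> * ?m J) + ennreal (\<Sum>J\<in>F. \<alpha> * ?d J - \<beta> * ?m J)"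
      using insert.hyps by (simp add: ennreal_add_le)
    then show ?case using insert by (simp) (meson add_left_mono order_trans)
  qed simp
  also have "\<dots> \<le> phi_sum \<phi> f P"
    unfolding phi_sum_def
  proof (rule sum_mono)
    fix J assume J: "J \<in> P"
    obtain c d where cd: "c \<le> d" "?m J = d - c" "Inf J = c" "Sup J = d"
      using subdivisions_D[OF P J] by metis
    show "ennreal (\<alpha> * ?d J - \<beta> * ?m J) \<le> \<phi> (?d J / ?m J) * ennreal (?m J)"
    proof (cases "c = d")
      case True then show ?thesis using cd by simp
    next
      case False
      have "sgn (f d - f c) * (f d - f c) = \<bar>f c - f d\<bar>" by (simp add: sgn_if)
      moreover have "\<bar>sgn (f d - f c)\<bar> \<le> 1" by (simp add: sgn_if)
      ultimately show ?thesis
        using affine_minorant_increment[OF m, of "sgn (f d - f c)" c d f] cd False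
        by (simp add: mult.assoc)
    qed
  qed
  also have "\<dots> \<le> phi_variation \<phi> a b f" by (rule phi_sum_le_variation[OF ab P])
  finally have "(\<Sum>J\<in>P. \<alpha> * ?d J - \<beta> * ?m J) \<le> enn2real (phi_variation \<phi> a b f)"
    using V by (metis (no_types, lifting) enn2real_nonneg ennreal_enn2real ennreal_le_iff infinity_ennreal_def)
  then show ?thesis by (simp add: sum_subtractf sum_distrib_left)
qed

lemma bounded_variation_if_finite:
  assumes "a < b" "Phi_c \<phi>" "phi_variation \<phi> a b f < \<infinity>"
  shows "bounded_variation_on a b f"
proof -
  obtain \<alpha> \<beta> where m: "affine_minorant \<phi> \<alpha> \<beta>" and "0 < ennreal \<alpha>"
    using ex_affine_minorant_slope[OF assms(2) growth_const_pos[OF assms(2)]] .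
  then have \<alpha>: "0 < \<alpha>" "0 \<le> \<beta>" by (auto simp: affine_minorant_def)
  have "(\<Sum>J\<in>P. \<bar>f (Inf J) - f (Sup J)\<bar>) \<le> (enn2real (phi_variation \<phi> a b f) + \<beta> * (b - a)) / \<alpha>"
    if "P \<in> partitions a b" for P
  proof -
    have P: "P \<in> subdivisions a b" using that partitions_subset_subdivisions by blast
    have "\<beta> * (\<Sum>J\<in>P. measure lborel J) \<le> \<beta> * (b - a)"
      using measure_subdivisions_le[OF _ P] assms(1) \<alpha> by (intro mult_left_mono) auto
    then show ?thesis
      using sum_abs_increments_le[OF assms(1) P assms(3) m] \<alpha> by (simp add: field_simps)
  qed
  then show ?thesis unfolding bounded_variation_on_def by blast
qed

lemma absolutely_continuous_if_finite:
  assumes "a < b" "Phi_c \<phi>" "phi_variation \<phi> a b f < \<infinity>" "growth_const \<phi> = \<infinity>"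
  shows "absolutely_continuous_on a b f"
  unfolding absolutely_continuous_on_def
proof (intro allI impI)
  fix \<epsilon> :: real assume \<epsilon>: "0 < \<epsilon>"
  define V where "V = enn2real (phi_variation \<phi> a b f)"
  have V0: "0 \<le> V" by (simp add: V_def)
  have "ennreal (2 * (V + 1) / \<epsilon>) < growth_const \<phi>" using assms(4) by simp
  then obtain \<alpha> \<beta> where m: "affine_minorant \<phi> \<alpha> \<beta>" and *: "ennreal (2 * (V + 1) / \<epsilon>) < ennreal \<alpha>"
    using ex_affine_minorant_slope[OF assms(2)] by metis
  have \<alpha>\<beta>: "0 \<le> \<alpha>" "0 \<le> \<beta>" using m by (auto simp: affine_minorant_def)
  have "2 * (V + 1) / \<epsilon> < \<alpha>" using * \<epsilon> V0 by (subst (asm) ennreal_less_iff) auto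
  then have \<alpha>: "2 * (V + 1) < \<alpha> * \<epsilon>" using \<epsilon> by (simp add: field_simps)
  have \<alpha>0: "0 < \<alpha>" using \<alpha> V0 \<alpha>\<beta> by (cases "\<alpha> = 0") auto
  show "\<exists>\<delta>>0. \<forall>P. P division_of \<Union>P \<and> \<Union>P \<subseteq> {a..b} \<and> (\<Sum>J\<in>P. measure lborel J) < \<delta> \<longrightarrow>
        (\<Sum>J\<in>P. \<bar>f (Inf J) - f (Sup J)\<bar>) < \<epsilon>"
  proof (intro exI[of _ "1 / (\<beta> + 1)"] conjI allI impI)
    show "0 < 1 / (\<beta> + 1)" using \<alpha>\<beta> by simp
    fix P assume "P division_of \<Union>P \<and> \<Union>P \<subseteq> {a..b} \<and> (\<Sum>J\<in>P. measure lborel J) < 1 / (\<beta> + 1)"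
    then have P: "P \<in> subdivisions a b" and s: "(\<Sum>J\<in>P. measure lborel J) < 1 / (\<beta> + 1)"
      by (auto simp: subdivisions_def)
    have "\<beta> * (\<Sum>J\<in>P. measure lborel J) \<le> \<beta> * (1 / (\<beta> + 1))"
      using s \<alpha>\<beta> by (intro mult_left_mono) auto
    also have "\<dots> \<le> 1" using \<alpha>\<beta> by (simp add: field_simps)
    finally have "\<alpha> * (\<Sum>J\<in>P. \<bar>f (Inf J) - f (Sup J)\<bar>) \<le> V + 1"
      using sum_abs_increments_le[OF assms(1) P assms(3) m] by (simp add: V_def)
    also have "\<dots> < \<alpha> * \<epsilon>" using \<alpha> V0 by simp
    finally show "(\<Sum>J\<in>P. \<bar>f (Inf J) - f (Sup J)\<bar>) < \<epsilon>" using \<alpha>0 by simp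
  qed
qed

lemma left_continuous_if_absolutely_continuous:
  assumes "absolutely_continuous_on a b f"
  shows "left_continuous_on a b f"
  unfolding left_continuous_on_def
proof
  fix x assume x: "x \<in> {a<..b}"
  show "(f \<longlongrightarrow> f x) (at_left x)"
  proof (rule tendstoI)
    fix e :: real assume "0 < e"
    then obtain \<delta> where \<delta>: "\<delta> > 0" "\<And>P. P division_of \<Union>P \<Longrightarrow> \<Union>P \<subseteq> {a..b} \<Longrightarrow>
        (\<Sum>J\<in>P. measure lborel J) < \<delta> \<Longrightarrow> (\<Sum>J\<in>P. \<bar>f (Inf J) - f (Sup J)\<bar>) < e"
      using assms unfolding absolutely_continuous_on_def by meson
    show "\<forall>\<^sub>F y in at_left x. dist (f y) (f x) < e"
    proof (rule eventually_at_leftI)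
      show "max a (x - \<delta>) < x" using x \<delta> by auto
      fix y assume y: "y \<in> {max a (x - \<delta>)<..<x}"
      have "{{y..x}} division_of \<Union>{{y..x}}"
        using y division_of_self[of y x] by simp
      then show "dist (f y) (f x) < e"
        using \<delta>(2)[of "{{y..x}}"] x y by (auto simp: dist_real_def)
    qed
  qed
qed

definition var_fun :: "(real \<Rightarrow> ennreal) \<Rightarrow> real \<Rightarrow> (real \<Rightarrow> real) \<Rightarrow> real \<Rightarrow> ennreal" where
  "var_fun \<phi> a f x = (SUP P\<in>subdivisions a x. phi_sum \<phi> f P)"

lemma var_fun_le: "a < b \<Longrightarrow> var_fun \<phi> a f b \<le> phi_variation \<phi> a b f"
  unfolding var_fun_def by (rule SUP_least) (rule phi_sum_le_variation)

lemma var_fun_mono: "x \<le> y \<Longrightarrow> var_fun \<phi> a f x \<le> var_fun \<phi> a f y"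
  unfolding var_fun_def by (rule SUP_subset_mono) (fastforce simp: subdivisions_def)+

lemma var_fun_self: "var_fun \<phi> a f a = 0"
proof -
  have "phi_sum \<phi> f P = 0" if P: "P \<in> subdivisions a a" for P
    unfolding phi_sum_def
  proof (rule sum.neutral, rule ballI)
    fix J assume "J \<in> P"
    then obtain c d where "c \<le> d" "a \<le> c" "d \<le> a" "measure lborel J = d - c"
      using subdivisions_D[OF P] by metis
    then show "\<phi> (\<bar>f (Inf J) - f (Sup J)\<bar> / measure lborel J) * ennreal (measure lborel J) = 0"
      by simp
  qed
  then show ?thesis unfolding var_fun_def by (simp add: SUP_constant bot_ennreal cong: SUP_cong)
qed

lemma var_fun_superadditive:
  assumes "a \<le> c" "c < d"
  shows "var_fun \<phi> a f c + \<phi> (\<bar>f c - f d\<bar> / (d - c)) * ennreal (d - c) \<le> var_fun \<phi> a f d"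
proof -
  have ne: "subdivisions a c \<noteq> {}" by (auto simp: subdivisions_def intro!: exI[of _ "{}"])
  have "phi_sum \<phi> f P + \<phi> (\<bar>f c - f d\<bar> / (d - c)) * ennreal (d - c) \<le> var_fun \<phi> a f d"
    if P: "P \<in> subdivisions a c" for P
  proof -
    have PU: "P division_of \<Union>P" "\<Union>P \<subseteq> {a..c}" using P by (auto simp: subdivisions_def)
    have nin: "{c..d} \<notin> P" using PU(2) assms by (metis Union_upper atLeastAtMost_iff atLeastatMost_subset_iff
        less_eq_real_def not_less order_trans)
    have "x < c" if "x \<in> interior (\<Union>P)" for x
      using subsetD[OF interior_mono[OF PU(2)] that] by simp
    then have "interior (\<Union>P) \<inter> interior {c..d} = {}"
      by (metis disjoint_iff greaterThanLessThan_iff interior_atLeastAtMost_real less_asym)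
    then have "P \<union> {{c..d}} division_of \<Union>P \<union> {c..d}"
      using division_of_self[of c d] assms(2) by (intro division_disjoint_union[OF PU(1)]) (simp_all del: interior_atLeastAtMost_real)
    moreover have "\<Union>P \<union> {c..d} = \<Union>(P \<union> {{c..d}})" by auto
    moreover have "\<Union>P \<subseteq> {a..d}"
      by (rule order_trans[OF PU(2)]) (use assms in auto)
    then have "\<Union>P \<union> {c..d} \<subseteq> {a..d}" using assms by (intro Un_least) auto
    ultimately have "P \<union> {{c..d}} \<in> subdivisions a d"
      unfolding subdivisions_def by (metis (mono_tags, lifting) mem_Collect_eq)
    then have "phi_sum \<phi> f (P \<union> {{c..d}}) \<le> var_fun \<phi> a f d"
      unfolding var_fun_def by (rule SUP_upper[where f = "phi_sum \<phi> f"])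
    then show ?thesis
      using nin finite_subdivisions[OF P] assms(2) by (simp add: phi_sum_def add.commute)
  qed
  then show ?thesis
    unfolding var_fun_def[of \<phi> a f c] using ne
    by (subst ennreal_SUP_add_left[symmetric]) (auto intro: SUP_least)
qed

lemma var_fun_minus_affine_mono:
  assumes ab: "a < b" and V: "phi_variation \<phi> a b f < \<infinity>"
    and m: "affine_minorant \<phi> \<alpha> \<beta>" and "\<bar>\<sigma>\<bar> \<le> 1"
  shows "mono_on {a..b} (\<lambda>x. enn2real (var_fun \<phi> a f x) - \<alpha> * \<sigma> * f x + \<beta> * x)"
proof (rule mono_onI)
  fix c d assume cd: "c \<in> {a..b}" "d \<in> {a..b}" "c \<le> d"
  have fin: "var_fun \<phi> a f x < \<infinity>" if "x \<le> b" for x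
    using var_fun_mono[OF that] var_fun_le[OF ab] V by (meson le_less_trans)
  show "enn2real (var_fun \<phi> a f c) - \<alpha> * \<sigma> * f c + \<beta> * c \<le> enn2real (var_fun \<phi> a f d) - \<alpha> * \<sigma> * f d + \<beta> * d"
  proof (cases "c = d")
    case False
    then have "c < d" using cd by simp
    define u where "u = \<alpha> * \<sigma> * (f d - f c) - \<beta> * (d - c)"
    have "var_fun \<phi> a f c + ennreal u \<le> var_fun \<phi> a f d"
      using affine_minorant_increment[OF m assms(4) \<open>c < d\<close>, of f]
        var_fun_superadditive[of a c d \<phi> f] cd \<open>c < d\<close>
      by (simp add: u_def) (meson add_left_mono order_trans)
    then have "enn2real (var_fun \<phi> a f c) + max 0 u \<le> enn2real (var_fun \<phi> a f d)"
      using fin[of c] fin[of d] cd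
      by (cases "var_fun \<phi> a f c"; cases "var_fun \<phi> a f d"; cases "0 \<le> u")
        (auto simp: ennreal_neg max_def simp flip: ennreal_plus)
    then show ?thesis by (simp add: u_def algebra_simps)
  qed simp
qed

section \<open>Derivative measures\<close>

lemma sets_borel_Icc: "A \<in> sets (borel_Icc a b) \<longleftrightarrow> A \<in> sets borel \<and> A \<subseteq> {a..b}"
  by (subst sets_restrict_space_iff) auto

lemma finite_signed_measure_sums:
  assumes "finite_signed_measure M \<mu>" "range A \<subseteq> sets M" "disjoint_family A"
  shows "(\<lambda>n. \<mu> (A n)) sums \<mu> (\<Union>n. A n)"
  using assms by (simp add: finite_signed_measure_def)

lemma finite_signed_measure_Int:
  assumes "finite_signed_measure M \<mu>" "N \<in> sets M"
  shows "finite_signed_measure M (\<lambda>A. \<mu> (A \<inter> N))"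
  unfolding finite_signed_measure_def
proof (intro conjI allI impI)
  fix A :: "nat \<Rightarrow> 'a set" assume A: "range A \<subseteq> sets M \<and> disjoint_family A"
  have "(\<lambda>n. \<mu> (A n \<inter> N)) sums \<mu> (\<Union>n. A n \<inter> N)"
    using A assms(2)
    by (intro finite_signed_measure_sums[OF assms(1)]) (auto simp: disjoint_family_on_def)
  moreover have "(\<Union>n. A n \<inter> N) = (\<Union>n. A n) \<inter> N" by blast
  ultimately show "(\<lambda>n. \<mu> (A n \<inter> N)) sums \<mu> ((\<Union>n. A n) \<inter> N)" by simp
qed (use assms(1) in \<open>simp add: finite_signed_measure_def\<close>)

lemma finite_signed_measure_lincomb:
  assumes "finite_signed_measure M \<mu>" "finite_signed_measure M \<nu>"
  shows "finite_signed_measure M (\<lambda>A. x * \<mu> A + y * \<nu> A)"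
  using assms unfolding finite_signed_measure_def
  by (auto intro!: sums_add sums_mult)

lemma finite_signed_measure_Un:
  assumes "finite_signed_measure M \<mu>" "A \<in> sets M" "B \<in> sets M" "A \<inter> B = {}"
  shows "\<mu> (A \<union> B) = \<mu> A + \<mu> B"
proof -
  have "\<mu> {} = 0" using assms(1) by (simp add: finite_signed_measure_def)
  then have 1: "(\<lambda>n. \<mu> (binaryset A B n)) sums (\<mu> A + \<mu> B)" by (rule binaryset_sums)
  have "disjoint_family (binaryset A B)"
    using assms(4) by (auto simp: disjoint_family_on_def binaryset_def)
  moreover have "range (binaryset A B) \<subseteq> sets M" using assms by (simp add: range_binaryset_eq)
  ultimately have "(\<lambda>n. \<mu> (binaryset A B n)) sums \<mu> (\<Union>n. binaryset A B n)"
    using assms(1) by (simp add: finite_signed_measure_def)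
  then have "(\<lambda>n. \<mu> (binaryset A B n)) sums \<mu> (A \<union> B)" by (simp add: UN_binaryset_eq)
  then show ?thesis using 1 sums_unique2 by blast
qed

lemma finite_signed_measure_measure:
  assumes "sets L = sets borel" "emeasure L {a..b} < \<infinity>"
  shows "finite_signed_measure (borel_Icc a b) (measure L)"
  unfolding finite_signed_measure_def
proof (intro conjI allI impI)
  fix A :: "nat \<Rightarrow> real set"
  assume A: "range A \<subseteq> sets (borel_Icc a b) \<and> disjoint_family A"
  then have *: "A n \<in> sets L" "A n \<subseteq> {a..b}" for n
    using assms(1) by (auto simp: sets_borel_Icc image_subset_iff)
  then have "emeasure L (\<Union>n. A n) \<le> emeasure L {a..b}"
    using assms(1) by (intro emeasure_mono) auto
  then have "emeasure L (\<Union>n. A n) \<noteq> \<infinity>" using assms(2) by (metis infinity_ennreal_def not_le top.not_eq_extremum)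
  then show "(\<lambda>n. measure L (A n)) sums measure L (\<Union>n. A n)"
    using A * by (intro measure_UNION) auto
qed simp

lemma is_deriv_measureD:
  assumes "is_deriv_measure a b f \<mu>"
  shows "finite_signed_measure (borel_Icc a b) \<mu>" "\<mu> {b} = 0"
    "x \<in> {a..b} \<Longrightarrow> f x - f a = \<mu> {a..<x}"
proof -
  show "finite_signed_measure (borel_Icc a b) \<mu>" "\<mu> {b} = 0"
    using assms by (simp_all only: is_deriv_measure_def)
  show "f x - f a = \<mu> {a..<x}" if "x \<in> {a..b}"
    using assms that unfolding is_deriv_measure_def by (metis add_diff_cancel_left')
qed

lemma is_deriv_measureI:
  assumes "finite_signed_measure (borel_Icc a b) \<mu>" "\<mu> {b} = 0"
    "\<And>x. x \<in> {a..b} \<Longrightarrow> f x - f a = \<mu> {a..<x}"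
  shows "is_deriv_measure a b f \<mu>"
  unfolding is_deriv_measure_def
proof (intro conjI ballI)
  fix x assume "x \<in> {a..b}"
  then show "f x = f a + \<mu> {a..<x}" using assms(3)[of x] by linarith
qed (rule assms)+

lemma is_deriv_measure_lincomb:
  assumes "is_deriv_measure a b f \<mu>" "is_deriv_measure a b g \<nu>"
  shows "is_deriv_measure a b (\<lambda>t. x * f t + y * g t) (\<lambda>A. x * \<mu> A + y * \<nu> A)"
proof (rule is_deriv_measureI)
  fix t assume t: "t \<in> {a..b}"
  show "x * f t + y * g t - (x * f a + y * g a) = x * \<mu> {a..<t} + y * \<nu> {a..<t}"
    unfolding is_deriv_measureD(3)[OF assms(1) t, symmetric] is_deriv_measureD(3)[OF assms(2) t, symmetric]
    by (simp add: algebra_simps)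
next
  show "x * \<mu> {b} + y * \<nu> {b} = 0"
    using is_deriv_measureD(2)[OF assms(1)] is_deriv_measureD(2)[OF assms(2)] by simp
qed (rule finite_signed_measure_lincomb[OF is_deriv_measureD(1)[OF assms(1)] is_deriv_measureD(1)[OF assms(2)]])

lemma is_deriv_measure_unique:
  assumes "a \<le> b" "is_deriv_measure a b f \<mu>" "is_deriv_measure a b f \<mu>'"
    and A: "A \<in> sets (borel_Icc a b)"
  shows "\<mu> A = \<mu>' A"
proof -
  let ?P = "\<lambda>A. \<mu> (A \<inter> {a..b}) = \<mu>' (A \<inter> {a..b})"
  have fsm: "finite_signed_measure (borel_Icc a b) \<mu>" "finite_signed_measure (borel_Icc a b) \<mu>'"
    and pt: "\<mu> {b} = \<mu>' {b}"
    using is_deriv_measureD(1,2)[OF assms(2)] is_deriv_measureD(1,2)[OF assms(3)] by simp_all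
  have incr: "\<mu> {a..<x} = \<mu>' {a..<x}" if "x \<in> {a..b}" for x
    using is_deriv_measureD(3)[OF assms(2) that] is_deriv_measureD(3)[OF assms(3) that] by simp
  have empty: "\<mu> {} = \<mu>' {}" using fsm by (simp add: finite_signed_measure_def)
  have I: "\<mu> {a..b} = \<mu>' {a..b}"
  proof -
    have eq: "{a..b} = {a..<b} \<union> {b}" using assms(1) by auto
    have "{a..<b} \<in> sets (borel_Icc a b)" "{b} \<in> sets (borel_Icc a b)"
      using assms(1) by (auto simp: sets_borel_Icc)
    then have *: "\<nu> {a..b} = \<nu> {a..<b} + \<nu> {b}" if "finite_signed_measure (borel_Icc a b) \<nu>" for \<nu>
      using finite_signed_measure_Un[OF that, of "{a..<b}" "{b}"] eq by simp
    then show ?thesis using *[OF fsm(1)] *[OF fsm(2)] incr[of b] pt assms(1) by simp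
  qed
  have stable: "Int_stable (range (lessThan :: real \<Rightarrow> _))"
  proof -
    have "{..<x} \<inter> {..<y} = {..<min x y}" for x y :: real by auto
    then show ?thesis by (auto simp: Int_stable_def)
  qed
  have sb: "sets borel = sigma_sets UNIV (range (lessThan :: real \<Rightarrow> _))"
    by (subst borel_Iio) simp
  have sub: "range (lessThan :: real \<Rightarrow> _) \<subseteq> Pow UNIV" by simp
  have "A \<in> sigma_sets UNIV (range lessThan)"
    using A unfolding sets_borel_Icc sb by simp
  with stable sub have "?P A"
  proof (induction rule: sigma_sets_induct_disjoint)
    case (basic A)
    then obtain x where x: "A = {..<x}" by auto
    consider "x \<le> a" | "x \<in> {a..b}" | "b < x" by fastforce
    then show ?case
    proof cases
      case 1
      then have "A \<inter> {a..b} = {}" using x by auto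
      then show ?thesis using empty by simp
    next
      case 2
      then have "A \<inter> {a..b} = {a..<x}" using x by auto
      then show ?thesis using incr 2 by simp
    next
      case 3
      then have "A \<inter> {a..b} = {a..b}" using x by auto
      then show ?thesis using I by simp
    qed
  next
    case (compl A)
    have s: "A \<inter> {a..b} \<in> sets (borel_Icc a b)" "(UNIV - A) \<inter> {a..b} \<in> sets (borel_Icc a b)"
      using compl.hyps unfolding sb[symmetric] by (auto simp: sets_borel_Icc)
    have "A \<inter> {a..b} \<union> (UNIV - A) \<inter> {a..b} = {a..b}" "A \<inter> {a..b} \<inter> ((UNIV - A) \<inter> {a..b}) = {}" by auto
    then have *: "\<nu> {a..b} = \<nu> (A \<inter> {a..b}) + \<nu> ((UNIV - A) \<inter> {a..b})"
      if "finite_signed_measure (borel_Icc a b) \<nu>" for \<nu>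
      using finite_signed_measure_Un[OF that s] by simp
    show ?case using I compl.IH *[OF fsm(1)] *[OF fsm(2)] by simp
  next
    case (union B)
    let ?B = "\<lambda>n. B n \<inter> {a..b}"
    have "range ?B \<subseteq> sets (borel_Icc a b)"
      using union.hyps(2) unfolding sb[symmetric] by (auto simp: sets_borel_Icc image_subset_iff)
    moreover have "disjoint_family ?B"
      using union.hyps(1) by (auto simp: disjoint_family_on_def)
    ultimately have "(\<lambda>n. \<mu> (?B n)) sums \<mu> (\<Union>n. ?B n)" "(\<lambda>n. \<mu>' (?B n)) sums \<mu>' (\<Union>n. ?B n)"
      using finite_signed_measure_sums[OF fsm(1)] finite_signed_measure_sums[OF fsm(2)] by blast+
    moreover have "(\<lambda>n. \<mu> (?B n)) = (\<lambda>n. \<mu>' (?B n))" using union.IH by blast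
    ultimately have "\<mu> (\<Union>n. ?B n) = \<mu>' (\<Union>n. ?B n)" using sums_unique2 by metis
    moreover have "(\<Union>n. ?B n) = (\<Union>n. B n) \<inter> {a..b}" by blast
    ultimately show ?case by simp
  qed (use empty in auto)
  moreover have "A \<inter> {a..b} = A" using A by (auto simp: sets_borel_Icc)
  ultimately show ?thesis by simp
qed

lemma is_deriv_measure_lborel:
  assumes "a \<le> b"
  shows "is_deriv_measure a b (\<lambda>x. x) (measure lborel)"
proof (rule is_deriv_measureI)
  show "finite_signed_measure (borel_Icc a b) (measure lborel)"
    by (rule finite_signed_measure_measure) (simp_all add: emeasure_lborel_Icc_eq)
qed auto

lemma ex_deriv_measure_mono:
  fixes h :: "real \<Rightarrow> real"
  assumes ab: "a < b" and mono: "mono_on {a..b} h" and lc: "left_continuous_on a b h"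
  obtains L where "sets L = sets borel" "emeasure L {a..b} < \<infinity>" "is_deriv_measure a b h (measure L)"
proof -
  define cl where "cl = (\<lambda>x. max a (min b x))"
  define G where "G = (\<lambda>x. - h (cl (- x)))"
  have cl: "cl x \<in> {a..b}" for x using ab by (auto simp: cl_def)
  have Gm: "G x \<le> G y" if "x \<le> y" for x y
    unfolding G_def using cl mono that by (auto intro!: mono_onD[OF mono] simp: cl_def)
  have lcl: "((\<lambda>x. h (cl x)) \<longlongrightarrow> h (cl x)) (at_left x)" for x
  proof -
    consider "x \<le> a" | "x \<in> {a<..b}" | "b < x" by fastforce
    then show ?thesis
    proof cases
      case 1
      have "\<forall>\<^sub>F y in at_left x. h (cl y) = h (cl x)"
        by (rule eventually_at_leftI[of "x - 1"]) (use 1 ab in \<open>auto simp: cl_def\<close>)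
      then show ?thesis by (rule tendsto_eventually)
    next
      case 2
      have "\<forall>\<^sub>F y in at_left x. h (cl y) = h y"
        by (rule eventually_at_leftI[of a]) (use 2 ab in \<open>auto simp: cl_def\<close>)
      moreover have "h (cl x) = h x" using 2 by (simp add: cl_def)
      moreover have "(h \<longlongrightarrow> h x) (at_left x)" using lc 2 by (simp add: left_continuous_on_def)
      ultimately show ?thesis by (simp add: tendsto_cong)
    next
      case 3
      have "\<forall>\<^sub>F y in at_left x. h (cl y) = h (cl x)"
        by (rule eventually_at_leftI[of b]) (use 3 ab in \<open>auto simp: cl_def\<close>)
      then show ?thesis by (rule tendsto_eventually)
    qed
  qed
  have Gr: "continuous (at_right x) G" for x
  proof -
    have "((\<lambda>y. h (cl (- y))) \<longlongrightarrow> h (cl (- x))) (at_right x)"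
      using lcl[of "- x"] by (subst (asm) filterlim_at_left_to_right) simp
    then show ?thesis by (auto simp: continuous_within G_def intro: tendsto_minus)
  qed
  \<comment> \<open>\<^const>\<open>interval_measure\<close> expects right-continuous functions, hence the reflection at \<open>0\<close>.\<close>
  define L where "L = distr (interval_measure G) borel uminus"
  have sL: "sets L = sets borel" by (simp add: L_def)
  have em: "emeasure L {c..<d} = ennreal (h (cl d) - h (cl c))" if "c \<le> d" for c d
  proof -
    have "uminus -` {c..<d} = {- d<..- c}" by auto
    then have "emeasure L {c..<d} = emeasure (interval_measure G) {- d<..- c}"
      unfolding L_def by (subst emeasure_distr) auto
    also have "\<dots> = ennreal (G (- c) - G (- d))"
      using that by (intro emeasure_interval_measure_Ioc Gm Gr) auto
    finally show ?thesis by (simp add: G_def)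
  qed
  have fin: "emeasure L {a..b} < \<infinity>"
  proof -
    have "emeasure L {a..b} \<le> emeasure L {a..<b+1}" by (rule emeasure_mono) (auto simp: sL)
    then show ?thesis using em[of a "b + 1"] ab by (simp add: le_less_trans)
  qed
  have "measure L {b} \<le> measure L {b..<b+1}"
    using em[of b "b + 1"] by (intro measure_mono_fmeasurable) (auto simp: sL fmeasurable_def)
  also have "\<dots> = 0" using em[of b "b + 1"] ab by (simp add: measure_def cl_def)
  finally have "measure L {b} = 0" by (simp add: measure_le_0_iff)
  moreover have "h x - h a = measure L {a..<x}" if "x \<in> {a..b}" for x
  proof -
    have "h a \<le> h x" using mono_onD[OF mono, of a x] that by simp
    moreover have "cl a = a" "cl x = x" using that by (auto simp: cl_def)
    ultimately show ?thesis using em[of a x] that by (simp add: measure_def)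
  qed
  ultimately have "is_deriv_measure a b h (measure L)"
    by (intro is_deriv_measureI finite_signed_measure_measure[OF sL fin])
  then show ?thesis using that sL fin by blast
qed

lemma ex_left_limits_mono:
  fixes G :: "real \<Rightarrow> real"
  assumes mono: "mono_on {a..b} G"
  obtains G' where "G' a = G a" "\<And>x. x \<in> {a<..b} \<Longrightarrow> (G \<longlongrightarrow> G' x) (at_left x)"
    "mono_on {a..b} G'" "left_continuous_on a b G'" "\<And>x. x \<in> {a..b} \<Longrightarrow> G' x \<le> G x"
proof -
  define G' where "G' = (\<lambda>x. if x \<le> a then G a else SUP y\<in>{a..<x}. G y)"
  have bdd: "bdd_above (G ` {a..<x})" if "x \<in> {a..b}" for x
    using that by (intro bdd_aboveI2[of _ _ "G x"] mono_onD[OF mono]) auto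
  have up: "G y \<le> G' x" if "x \<in> {a..b}" "a \<le> y" "y < x" for x y
    using that bdd[of x] by (auto simp: G'_def intro: cSUP_upper)
  have lo: "\<exists>y\<in>{a..<x}. z < G y" if "x \<in> {a<..b}" "z < G' x" for x z
    using that less_cSUP_iff[OF _ bdd, of x z] by (auto simp: G'_def)
  have le: "G' x \<le> G x" if "x \<in> {a..b}" for x
    using that by (auto simp: G'_def intro!: cSUP_least mono_onD[OF mono])
  have m: "mono_on {a..b} G'"
  proof (rule mono_onI)
    fix x y assume xy: "x \<in> {a..b}" "y \<in> {a..b}" "x \<le> y"
    show "G' x \<le> G' y"
    proof (cases "x = y")
      case False
      then show ?thesis using le[of x] up[of y x] xy by simp
    qed simp
  qed
  have lim: "(G \<longlongrightarrow> G' x) (at_left x)" if x: "x \<in> {a<..b}" for x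
  proof (rule increasing_tendsto)
    show "\<forall>\<^sub>F y in at_left x. G y \<le> G' x"
      by (rule eventually_at_leftI[of a]) (use x up in auto)
    fix z assume "z < G' x"
    then obtain y0 where y0: "y0 \<in> {a..<x}" "z < G y0" using lo[OF x] by blast
    show "\<forall>\<^sub>F y in at_left x. z < G y"
    proof (rule eventually_at_leftI[of y0])
      fix y assume "y \<in> {y0<..<x}"
      then have "G y0 \<le> G y" using y0 x by (intro mono_onD[OF mono]) auto
      then show "z < G y" using y0 by simp
    qed (use y0 in auto)
  qed
  have "left_continuous_on a b G'"
    unfolding left_continuous_on_def
  proof
    fix x assume x: "x \<in> {a<..b}"
    show "(G' \<longlongrightarrow> G' x) (at_left x)"
    proof (rule increasing_tendsto)
      show "\<forall>\<^sub>F y in at_left x. G' y \<le> G' x"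
        by (rule eventually_at_leftI[of a]) (use x in \<open>auto intro!: mono_onD[OF m]\<close>)
      fix z assume "z < G' x"
      then obtain y0 where y0: "y0 \<in> {a..<x}" "z < G y0" using lo[OF x] by blast
      show "\<forall>\<^sub>F y in at_left x. z < G' y"
      proof (rule eventually_at_leftI[of y0])
        fix y assume "y \<in> {y0<..<x}"
        then have "G y0 \<le> G' y" using y0 x by (intro up) auto
        then show "z < G' y" using y0 by simp
      qed (use y0 in auto)
    qed
  qed
  moreover have "G' a = G a" by (simp add: G'_def)
  ultimately show ?thesis using that lim m le by blast
qed

section \<open>Lebesgue decomposition\<close>

lemma is_lebesgue_decompositionD:
  assumes "is_lebesgue_decomposition a b \<mu> g \<nu>"
  shows "set_integrable lborel {a..b} g" "finite_signed_measure (borel_Icc a b) \<nu>"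
    "A \<in> sets (borel_Icc a b) \<Longrightarrow> \<mu> A = (LINT x:A|lborel. g x) + \<nu> A"
  using assms by (auto simp: is_lebesgue_decomposition_def)

lemma is_lebesgue_decomposition_nullE:
  assumes "is_lebesgue_decomposition a b \<mu> g \<nu>"
  obtains N where "N \<in> null_sets lborel" "N \<subseteq> {a..b}"
    "\<And>A. A \<in> sets (borel_Icc a b) \<Longrightarrow> A \<inter> N = {} \<Longrightarrow> \<nu> A = 0"
  using assms unfolding is_lebesgue_decomposition_def
  by (auto simp: sets_borel_Icc null_sets_def)

lemma set_integral_null_set:
  fixes g :: "real \<Rightarrow> real"
  assumes "N \<in> null_sets lborel"
  shows "(LINT x:N|lborel. g x) = 0"
  unfolding set_lebesgue_integral_def
  by (rule integral_eq_zero_AE) (use AE_not_in[OF assms] in eventually_elim, simp)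

lemma is_lebesgue_decomposition_cong:
  assumes "is_lebesgue_decomposition a b \<mu> g \<nu>" "\<And>A. A \<in> sets (borel_Icc a b) \<Longrightarrow> \<mu> A = \<mu>' A"
  shows "is_lebesgue_decomposition a b \<mu>' g \<nu>"
  using assms by (auto simp: is_lebesgue_decomposition_def)

lemma is_lebesgue_decomposition_lincomb:
  assumes "is_lebesgue_decomposition a b \<mu> g \<nu>" "is_lebesgue_decomposition a b \<mu>' g' \<nu>'"
  shows "is_lebesgue_decomposition a b (\<lambda>A. x * \<mu> A + y * \<mu>' A) (\<lambda>t. x * g t + y * g' t)
    (\<lambda>A. x * \<nu> A + y * \<nu>' A)"
proof -
  note D = is_lebesgue_decompositionD[OF assms(1)] and D' = is_lebesgue_decompositionD[OF assms(2)]
  obtain N where N: "N \<in> null_sets lborel" "N \<subseteq> {a..b}"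
    "\<And>A. A \<in> sets (borel_Icc a b) \<Longrightarrow> A \<inter> N = {} \<Longrightarrow> \<nu> A = 0"
    using is_lebesgue_decomposition_nullE[OF assms(1)] by blast
  obtain N' where N': "N' \<in> null_sets lborel" "N' \<subseteq> {a..b}"
    "\<And>A. A \<in> sets (borel_Icc a b) \<Longrightarrow> A \<inter> N' = {} \<Longrightarrow> \<nu>' A = 0"
    using is_lebesgue_decomposition_nullE[OF assms(2)] by blast
  have U: "N \<union> N' \<in> null_sets lborel" using N(1) N'(1) by (rule null_sets.Un)
  have "\<exists>N\<in>sets (borel_Icc a b). emeasure lborel N = 0 \<and>
      (\<forall>A\<in>sets (borel_Icc a b). A \<inter> N = {} \<longrightarrow> x * \<nu> A + y * \<nu>' A = 0)"
  proof (intro bexI[of _ "N \<union> N'"] conjI ballI impI)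
    show "N \<union> N' \<in> sets (borel_Icc a b)" using U N(2) N'(2) by (auto simp: sets_borel_Icc)
    show "emeasure lborel (N \<union> N') = 0" using U by auto
    fix A assume "A \<in> sets (borel_Icc a b)" "A \<inter> (N \<union> N') = {}"
    then show "x * \<nu> A + y * \<nu>' A = 0" using N(3)[of A] N'(3)[of A] by (simp add: Int_Un_distrib)
  qed
  moreover have "set_integrable lborel {a..b} (\<lambda>t. x * g t + y * g' t)"
    using D(1) D'(1) by (intro set_integral_add set_integrable_mult_right)
  moreover have "x * \<mu> A + y * \<mu>' A =
      (LINT t:A|lborel. x * g t + y * g' t) + (x * \<nu> A + y * \<nu>' A)" if A: "A \<in> sets (borel_Icc a b)" for A
  proof -
    have "A \<in> sets lborel" "A \<subseteq> {a..b}" using A by (auto simp: sets_borel_Icc)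
    then have "set_integrable lborel A g" "set_integrable lborel A g'"
      using D(1) D'(1) set_integrable_subset by blast+
    then have "(LINT t:A|lborel. x * g t + y * g' t) = x * (LINT t:A|lborel. g t) + y * (LINT t:A|lborel. g' t)"
      by (subst set_integral_add) (auto intro: set_integrable_mult_right)
    then show ?thesis using D(3)[OF A] D'(3)[OF A] by (simp add: algebra_simps)
  qed
  ultimately show ?thesis
    unfolding is_lebesgue_decomposition_def
    using finite_signed_measure_lincomb[OF D(2) D'(2)] by blast
qed

lemma singular_part_unique:
  assumes "is_lebesgue_decomposition a b \<mu> g \<nu>" "is_lebesgue_decomposition a b \<mu> g' \<nu>'"
    and A: "A \<in> sets (borel_Icc a b)"
  shows "\<nu> A = \<nu>' A"
proof -
  obtain N where N: "N \<in> null_sets lborel" "N \<subseteq> {a..b}"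
    "\<And>A. A \<in> sets (borel_Icc a b) \<Longrightarrow> A \<inter> N = {} \<Longrightarrow> \<nu> A = 0"
    using is_lebesgue_decomposition_nullE[OF assms(1)] by blast
  obtain N' where N': "N' \<in> null_sets lborel" "N' \<subseteq> {a..b}"
    "\<And>A. A \<in> sets (borel_Icc a b) \<Longrightarrow> A \<inter> N' = {} \<Longrightarrow> \<nu>' A = 0"
    using is_lebesgue_decomposition_nullE[OF assms(2)] by blast
  let ?B = "A \<inter> (N \<union> N')" and ?C = "A - (N \<union> N')"
  have U: "N \<union> N' \<in> null_sets lborel" using N(1) N'(1) by (rule null_sets.Un)
  have B: "?B \<in> null_sets lborel"
    using A U by (intro null_set_Int1) (auto simp: sets_borel_Icc)
  have s: "?B \<in> sets (borel_Icc a b)" "?C \<in> sets (borel_Icc a b)"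
    using A U by (auto simp: sets_borel_Icc)
  have eq: "?B \<union> ?C = A" "?B \<inter> ?C = {}" by auto
  have "\<nu> A = \<nu> ?B + \<nu> ?C" "\<nu>' A = \<nu>' ?B + \<nu>' ?C"
    using finite_signed_measure_Un[OF is_lebesgue_decompositionD(2)[OF assms(1)] s eq(2)]
      finite_signed_measure_Un[OF is_lebesgue_decompositionD(2)[OF assms(2)] s eq(2)] unfolding eq by simp_all
  moreover have "\<nu> ?C = 0" "\<nu>' ?C = 0" using N(3)[OF s(2)] N'(3)[OF s(2)] by blast+
  moreover have "\<mu> ?B = \<nu> ?B" "\<mu> ?B = \<nu>' ?B"
    using is_lebesgue_decompositionD(3)[OF assms(1) s(1)] is_lebesgue_decompositionD(3)[OF assms(2) s(1)]
      set_integral_null_set[OF B] by simp_all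
  ultimately show ?thesis by simp
qed

lemma ex_maximal_null_set:
  fixes I :: "real set"
  assumes sL: "sets L = sets borel" and I: "I \<in> sets borel" and fin: "emeasure L I < \<infinity>"
  obtains N where "N \<in> null_sets lborel" "N \<subseteq> I"
    "\<And>A. A \<in> null_sets lborel \<Longrightarrow> A \<subseteq> I \<Longrightarrow> emeasure L (A - N) = 0"
proof -
  let ?S = "{A \<in> null_sets lborel. A \<subseteq> I}"
  have "{} \<in> ?S" by simp
  then have "emeasure L ` ?S \<noteq> {}" by blast
  then obtain s :: "nat \<Rightarrow> ennreal" where s: "range s \<subseteq> emeasure L ` ?S" "Sup (emeasure L ` ?S) = (SUP n. s n)"
    using ennreal_Sup_countable_SUP[of "emeasure L ` ?S"] by blast
  then have "\<forall>n. \<exists>A. A \<in> ?S \<and> s n = emeasure L A" by (meson image_iff range_subsetD)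
  then obtain A where A: "\<And>n. A n \<in> ?S" "\<And>n. s n = emeasure L (A n)" by metis
  define N where "N = (\<Union>n. A n)"
  have N: "N \<in> null_sets lborel" "N \<subseteq> I" using A(1) by (auto simp: N_def)
  have sb: "B \<in> sets L" if "B \<in> null_sets lborel" for B
    unfolding sL using null_setsD2[OF that] by simp
  have "emeasure L (A n) \<le> emeasure L N" for n
    using sb[OF N(1)] by (intro emeasure_mono) (auto simp: N_def)
  then have sup: "Sup (emeasure L ` ?S) \<le> emeasure L N"
    unfolding s(2) A(2) by (rule SUP_least)
  have "emeasure L (B - N) = 0" if B: "B \<in> null_sets lborel" "B \<subseteq> I" for B
  proof -
    have "B \<union> N \<in> ?S" using B N by (auto intro: null_sets.Un)
    then have "emeasure L (B \<union> N) \<le> emeasure L N" using sup by (meson SUP_upper order_trans)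
    moreover have "emeasure L ((B - N) \<union> N) = emeasure L (B - N) + emeasure L N"
      using sb[OF B(1)] sb[OF N(1)] by (intro plus_emeasure[symmetric]) auto
    moreover have "(B - N) \<union> N = B \<union> N" by auto
    moreover have "emeasure L N < \<infinity>"
      using emeasure_mono[OF N(2), of L] I sL fin by (simp add: le_less_trans)
    ultimately show ?thesis
      by (metis add.commute add.right_neutral antisym ennreal_add_left_cancel_le infinity_ennreal_def less_irrefl zero_le)
  qed
  then show ?thesis using that N by blast
qed

lemma ex_lebesgue_decomposition_measure:
  assumes sL: "sets L = sets borel" and fin: "emeasure L {a..b} < \<infinity>"
  obtains r N where "N \<in> null_sets lborel" "N \<subseteq> {a..b}" "r \<in> borel_measurable borel" "\<And>x. 0 \<le> r x"
    "is_lebesgue_decomposition a b (measure L) r (\<lambda>A. measure L (A \<inter> N))"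
proof -
  let ?I = "{a..b}"
  obtain N where N: "N \<in> null_sets lborel" "N \<subseteq> ?I"
    "\<And>A. A \<in> null_sets lborel \<Longrightarrow> A \<subseteq> ?I \<Longrightarrow> emeasure L (A - N) = 0"
    using ex_maximal_null_set[OF sL _ fin] by auto
  have sN: "N \<in> sets borel" using N(1) by auto
  have fA: "emeasure L A < \<infinity>" if "A \<subseteq> ?I" for A
    using emeasure_mono[OF that, of L] sL fin by (simp add: le_less_trans)
  define L' where "L' = density L (indicator (?I - N))"
  have L': "emeasure L' A = emeasure L (A \<inter> (?I - N))" if "A \<in> sets borel" for A
    unfolding L'_def using that sN sL by (subst emeasure_restricted) (auto simp: Int_commute)
  have "absolutely_continuous lborel L'"
    unfolding absolutely_continuous_def
  proof
    fix A :: "real set" assume A: "A \<in> null_sets lborel"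
    have "A \<inter> ?I \<in> null_sets lborel" using A by (intro null_set_Int2) auto
    then have "emeasure L (A \<inter> ?I - N) = 0" by (rule N(3)) auto
    moreover have "A \<inter> ?I - N = A \<inter> (?I - N)" by auto
    ultimately show "A \<in> null_sets L'" using L'[of A] A sL by (auto simp: null_sets_def L'_def)
  qed
  moreover have "sets L' = sets lborel" using sL by (simp add: L'_def)
  ultimately obtain f where f: "f \<in> borel_measurable lborel" "density lborel f = L'"
    using sigma_finite_measure.Radon_Nikodym[OF sigma_finite_lborel, of L'] by blast
  have ff: "(\<integral>\<^sup>+x. f x * indicator A x \<partial>lborel) = emeasure L (A \<inter> (?I - N))" if "A \<in> sets borel" for A
    using emeasure_density[OF f(1), of A] L'[OF that] that unfolding f(2) by simp
  have "(\<integral>\<^sup>+x. f x \<partial>lborel) < \<infinity>" using ff[of UNIV] fA[of "?I - N"] by simp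
  then have fae: "AE x in lborel. f x \<noteq> \<infinity>" using f(1) nn_integral_noteq_infinite[OF f(1)] by auto
  define r where "r = (\<lambda>x. enn2real (f x))"
  have rm: "r \<in> borel_measurable borel" using f(1) by (simp add: r_def)
  have r0: "0 \<le> r x" for x by (simp add: r_def)
  have nn: "(\<integral>\<^sup>+x. ennreal (indicator A x * r x) \<partial>lborel) = ennreal (measure L (A \<inter> (?I - N)))"
    if "A \<in> sets borel" for A
  proof -
    have "(\<integral>\<^sup>+x. ennreal (indicator A x * r x) \<partial>lborel) = (\<integral>\<^sup>+x. f x * indicator A x \<partial>lborel)"
      by (rule nn_integral_cong_AE, use fae in eventually_elim)
        (auto simp: r_def indicator_def less_top)
    also have "\<dots> = emeasure L (A \<inter> (?I - N))" by (rule ff[OF that])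
    also have "\<dots> = ennreal (measure L (A \<inter> (?I - N)))"
    proof (rule emeasure_eq_ennreal_measure)
      have "A \<inter> (?I - N) \<subseteq> ?I" by blast
      from fA[OF this] show "emeasure L (A \<inter> (?I - N)) \<noteq> top" by simp
    qed
    finally show ?thesis .
  qed
  have int: "set_integrable lborel A r" "(LINT x:A|lborel. r x) = measure L (A \<inter> (?I - N))"
    if "A \<in> sets borel" for A
  proof -
    have "integrable lborel (\<lambda>x. indicator A x * r x)"
      using nn[OF that] r0 rm that by (intro integrableI_nonneg) auto
    then show "set_integrable lborel A r" by (simp add: set_integrable_def)
    show "(LINT x:A|lborel. r x) = measure L (A \<inter> (?I - N))"
      unfolding set_lebesgue_integral_def using nn[OF that] r0 rm that
      by (subst integral_eq_nn_integral) auto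
  qed
  have "is_lebesgue_decomposition a b (measure L) r (\<lambda>A. measure L (A \<inter> N))"
    unfolding is_lebesgue_decomposition_def
  proof (intro conjI ballI)
    show "set_integrable lborel ?I r" by (rule int) simp
    show "\<exists>N'\<in>sets (borel_Icc a b). emeasure lborel N' = 0 \<and>
        (\<forall>A\<in>sets (borel_Icc a b). A \<inter> N' = {} \<longrightarrow> measure L (A \<inter> N) = 0)"
      using N by (intro bexI[of _ N]) (auto simp: sets_borel_Icc)
    show "finite_signed_measure (borel_Icc a b) (\<lambda>A. measure L (A \<inter> N))"
      using sN N(2) by (intro finite_signed_measure_Int finite_signed_measure_measure sL fin)
        (simp add: sets_borel_Icc)
    fix A assume "A \<in> sets (borel_Icc a b)"
    then have A: "A \<in> sets borel" "A \<subseteq> ?I" by (auto simp: sets_borel_Icc)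
    have "A = (A \<inter> (?I - N)) \<union> (A \<inter> N)" using A(2) by auto
    moreover have "measure L ((A \<inter> (?I - N)) \<union> (A \<inter> N)) = measure L (A \<inter> (?I - N)) + measure L (A \<inter> N)"
    proof (rule measure_Union)
      have "A \<inter> (?I - N) \<subseteq> ?I" "A \<inter> N \<subseteq> ?I" using A(2) by blast+
      from this[THEN fA] show "emeasure L (A \<inter> (?I - N)) \<noteq> \<infinity>" "emeasure L (A \<inter> N) \<noteq> \<infinity>"
        by simp_all
    qed (use A(1) sN sL in auto)
    ultimately show "measure L A = (LINT x:A|lborel. r x) + measure L (A \<inter> N)"
      using int(2)[OF A(1)] by simp
  qed
  then show ?thesis using that N rm r0 by blast
qed

section \<open>The dominating measure\<close>

lemma Phi_c_eq_SUP:
  assumes "Phi_c \<phi>" "0 \<le> t"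
  shows "\<phi> t = (SUP p\<in>{p \<in> \<rat> \<times> \<rat>. affine_minorant \<phi> (fst p) (snd p)}. ennreal (fst p * t - snd p))"
    (is "_ = (SUP p\<in>?S. ?f p)")
proof (rule antisym)
  show "\<phi> t \<le> (SUP p\<in>?S. ?f p)"
  proof (rule ccontr)
    assume "\<not> \<phi> t \<le> (SUP p\<in>?S. ?f p)"
    then have "(SUP p\<in>?S. ?f p) < \<phi> t" by simp
    then obtain \<alpha> \<beta> where "\<alpha> \<in> \<rat>" "\<beta> \<in> \<rat>" "affine_minorant \<phi> \<alpha> \<beta>" and
      *: "(SUP p\<in>?S. ?f p) < ennreal (\<alpha> * t - \<beta>)"
      using ex_affine_minorant[OF assms] by blast
    then have "(\<alpha>, \<beta>) \<in> ?S" by simp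
    from SUP_upper[OF this, of ?f] show False using * by simp
  qed
  show "(SUP p\<in>?S. ?f p) \<le> \<phi> t"
    using assms(2) by (intro SUP_least) (auto simp: affine_minorant_def)
qed

lemma measurable_Phi_c:
  assumes "Phi_c \<phi>" "h \<in> borel_measurable M" "\<And>x. 0 \<le> h x"
  shows "(\<lambda>x. \<phi> (h x)) \<in> borel_measurable M"
proof -
  have "countable {p \<in> \<rat> \<times> \<rat>. affine_minorant \<phi> (fst p) (snd p)}"
    by (rule countable_subset[of _ "\<rat> \<times> \<rat>"]) (auto intro: countable_SIGMA countable_rat)
  then have "(\<lambda>x. SUP p\<in>{p \<in> \<rat> \<times> \<rat>. affine_minorant \<phi> (fst p) (snd p)}. ennreal (fst p * h x - snd p))
      \<in> borel_measurable M"
    using assms(2) by (intro borel_measurable_SUP) auto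
  then show ?thesis using Phi_c_eq_SUP[OF assms(1) assms(3)] by simp
qed

lemma growth_const_mult_le:
  assumes "Phi_c \<phi>" "\<And>\<alpha> \<beta>. affine_minorant \<phi> \<alpha> \<beta> \<Longrightarrow> ennreal \<alpha> * T \<le> Y"
  shows "growth_const \<phi> * T \<le> Y"
proof -
  let ?K = "growth_const \<phi>"
  have "?K = (SUP y\<in>{..<?K}. y)" by simp
  then have "?K * T = (SUP y\<in>{..<?K}. y) * T" by simp
  also have "\<dots> = (SUP y\<in>{..<?K}. y * T)" by (rule SUP_mult_right_ennreal)
  also have "\<dots> \<le> Y"
  proof (rule SUP_least)
    fix y assume "y \<in> {..<?K}"
    then obtain \<alpha> \<beta> where "affine_minorant \<phi> \<alpha> \<beta>" "y < ennreal \<alpha>"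
      using ex_affine_minorant_slope[OF assms(1)] by blast
    then show "y * T \<le> Y" using assms(2) by (meson less_imp_le mult_right_mono order_trans zero_le)
  qed
  finally show ?thesis .
qed

lemma ex_var_fun_left_limit:
  assumes ab: "a < b" and \<phi>: "Phi_c \<phi>" and V: "phi_variation \<phi> a b f < \<infinity>"
    and lc: "left_continuous_on a b f"
  obtains F where "mono_on {a..b} F" "left_continuous_on a b F"
    "F b - F a \<le> enn2real (phi_variation \<phi> a b f)"
    "\<And>\<alpha> \<beta> \<sigma>. affine_minorant \<phi> \<alpha> \<beta> \<Longrightarrow> \<bar>\<sigma>\<bar> \<le> 1 \<Longrightarrow>
       mono_on {a..b} (\<lambda>x. F x - \<alpha> * \<sigma> * f x + \<beta> * x) \<and>
       left_continuous_on a b (\<lambda>x. F x - \<alpha> * \<sigma> * f x + \<beta> * x)"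
proof -
  define E where "E = (\<lambda>x. enn2real (var_fun \<phi> a f x))"
  have "affine_minorant \<phi> 0 0" by (simp add: affine_minorant_def)
  from var_fun_minus_affine_mono[OF ab V this, of 0] have "mono_on {a..b} E" by (simp add: E_def)
  then obtain F where F: "F a = E a" "\<And>x. x \<in> {a<..b} \<Longrightarrow> (E \<longlongrightarrow> F x) (at_left x)"
    "mono_on {a..b} F" "left_continuous_on a b F" "\<And>x. x \<in> {a..b} \<Longrightarrow> F x \<le> E x"
    using ex_left_limits_mono by blast
  have "F b \<le> E b" using F(5)[of b] ab by simp
  also have "E b \<le> enn2real (phi_variation \<phi> a b f)"
    unfolding E_def using V by (intro enn2real_mono var_fun_le[OF ab]) simp
  finally have "F b - F a \<le> enn2real (phi_variation \<phi> a b f)"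
    using F(1) by (simp add: E_def var_fun_self)
  moreover have "mono_on {a..b} (\<lambda>x. F x - \<alpha> * \<sigma> * f x + \<beta> * x) \<and>
       left_continuous_on a b (\<lambda>x. F x - \<alpha> * \<sigma> * f x + \<beta> * x)"
    if m: "affine_minorant \<phi> \<alpha> \<beta>" "\<bar>\<sigma>\<bar> \<le> 1" for \<alpha> \<beta> \<sigma>
  proof -
    let ?H = "\<lambda>x. E x - \<alpha> * \<sigma> * f x + \<beta> * x" and ?G = "\<lambda>x. F x - \<alpha> * \<sigma> * f x + \<beta> * x"
    have "mono_on {a..b} ?H" unfolding E_def by (rule var_fun_minus_affine_mono[OF ab V m])
    then obtain H where H: "H a = ?H a" "\<And>x. x \<in> {a<..b} \<Longrightarrow> (?H \<longlongrightarrow> H x) (at_left x)"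
      "mono_on {a..b} H"
      using ex_left_limits_mono by blast
    have eq: "?G x = H x" if x: "x \<in> {a..b}" for x
    proof (cases "x = a")
      case True
      then show ?thesis using H(1) F(1) by simp
    next
      case False
      then have x': "x \<in> {a<..b}" using x by auto
      have "(f \<longlongrightarrow> f x) (at_left x)" using lc x' by (simp add: left_continuous_on_def)
      then have "(?H \<longlongrightarrow> ?G x) (at_left x)"
        using F(2)[OF x'] by (intro tendsto_intros)
      then show ?thesis using H(2)[OF x'] tendsto_unique trivial_limit_at_left_real by blast
    qed
    have "mono_on {a..b} ?G"
    proof (rule mono_onI)
      fix r s assume "r \<in> {a..b}" "s \<in> {a..b}" "r \<le> s"
      then show "?G r \<le> ?G s" using mono_onD[OF H(3), of r s] eq by simp
    qed
    moreover have "left_continuous_on a b ?G"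
      using lc F(4) unfolding left_continuous_on_def by (auto intro!: tendsto_intros)
    ultimately show ?thesis by blast
  qed
  ultimately show ?thesis using that F(3,4) by blast
qed

lemma ex_dominating_measure:
  assumes ab: "a < b" and \<phi>: "Phi_c \<phi>" and V: "phi_variation \<phi> a b f < \<infinity>"
    and lc: "left_continuous_on a b f" and \<mu>: "is_deriv_measure a b f \<mu>"
  obtains L where "sets L = sets borel" "emeasure L {a..b} < \<infinity>"
    "emeasure L {a..b} \<le> phi_variation \<phi> a b f"
    "\<And>\<alpha> \<beta> \<sigma> A. affine_minorant \<phi> \<alpha> \<beta> \<Longrightarrow> \<bar>\<sigma>\<bar> \<le> 1 \<Longrightarrow> A \<in> sets (borel_Icc a b) \<Longrightarrow>
       \<alpha> * \<sigma> * \<mu> A - \<beta> * measure lborel A \<le> measure L A"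
proof -
  obtain F where F: "mono_on {a..b} F" "left_continuous_on a b F"
    "F b - F a \<le> enn2real (phi_variation \<phi> a b f)"
    "\<And>\<alpha> \<beta> \<sigma>. affine_minorant \<phi> \<alpha> \<beta> \<Longrightarrow> \<bar>\<sigma>\<bar> \<le> 1 \<Longrightarrow>
       mono_on {a..b} (\<lambda>x. F x - \<alpha> * \<sigma> * f x + \<beta> * x) \<and>
       left_continuous_on a b (\<lambda>x. F x - \<alpha> * \<sigma> * f x + \<beta> * x)"
    using ex_var_fun_left_limit[OF ab \<phi> V lc] by blast
  obtain L where L: "sets L = sets borel" "emeasure L {a..b} < \<infinity>" "is_deriv_measure a b F (measure L)"
    using ex_deriv_measure_mono[OF ab F(1,2)] by blast
  have "{a..<b} \<in> sets (borel_Icc a b)" "{b} \<in> sets (borel_Icc a b)" "{a..<b} \<inter> {b} = {}"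
    using ab by (auto simp: sets_borel_Icc)
  from finite_signed_measure_Un[OF is_deriv_measureD(1)[OF L(3)] this]
  have "measure L ({a..<b} \<union> {b}) = F b - F a"
    using is_deriv_measureD(2)[OF L(3)] is_deriv_measureD(3)[OF L(3), of b] ab by simp
  moreover have "{a..<b} \<union> {b} = {a..b}" using ab by auto
  ultimately have "measure L {a..b} = F b - F a" by simp
  then have "emeasure L {a..b} = ennreal (F b - F a)"
    using L(2) by (metis emeasure_eq_ennreal_measure infinity_ennreal_def less_irrefl)
  also have "\<dots> \<le> ennreal (enn2real (phi_variation \<phi> a b f))" by (rule ennreal_leI[OF F(3)])
  also have "\<dots> = phi_variation \<phi> a b f" using V by simp
  finally have le: "emeasure L {a..b} \<le> phi_variation \<phi> a b f" .
  have "\<alpha> * \<sigma> * \<mu> A - \<beta> * measure lborel A \<le> measure L A"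
    if m: "affine_minorant \<phi> \<alpha> \<beta>" "\<bar>\<sigma>\<bar> \<le> 1" and A: "A \<in> sets (borel_Icc a b)" for \<alpha> \<beta> \<sigma> A
  proof -
    obtain L' where L': "is_deriv_measure a b (\<lambda>x. F x - \<alpha> * \<sigma> * f x + \<beta> * x) (measure L')"
      using ex_deriv_measure_mono[OF ab] F(4)[OF m] by blast
    have "is_deriv_measure a b (\<lambda>x. 1 * (1 * F x + (- (\<alpha> * \<sigma>)) * f x) + \<beta> * x)
        (\<lambda>A. 1 * (1 * measure L A + (- (\<alpha> * \<sigma>)) * \<mu> A) + \<beta> * measure lborel A)"
      using ab by (intro is_deriv_measure_lincomb L(3) \<mu> is_deriv_measure_lborel) simp
    then have "is_deriv_measure a b (\<lambda>x. F x - \<alpha> * \<sigma> * f x + \<beta> * x)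
        (\<lambda>A. measure L A - \<alpha> * \<sigma> * \<mu> A + \<beta> * measure lborel A)"
      by simp
    from is_deriv_measure_unique[OF _ this L' A] ab
    have "measure L A - \<alpha> * \<sigma> * \<mu> A + \<beta> * measure lborel A = measure L' A" by simp
    then show ?thesis using measure_nonneg[of L' A] by linarith
  qed
  then show ?thesis using that L(1,2) le by blast
qed

lemma ex_decomposed_deriv_measure:
  assumes ab: "a < b" and \<phi>: "Phi_c \<phi>" and V: "phi_variation \<phi> a b f < \<infinity>"
    and lc: "left_continuous_on a b f"
  obtains \<mu> g \<nu> where "is_deriv_measure a b f \<mu>" "is_lebesgue_decomposition a b \<mu> g \<nu>"
proof -
  define P where "P = (\<lambda>h. \<exists>\<mu> g \<nu>. is_deriv_measure a b h \<mu> \<and> is_lebesgue_decomposition a b \<mu> g \<nu>)"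
  have lin: "P (\<lambda>t. x * h t + y * k t)" if "P h" "P k" for x y h k
    using that is_deriv_measure_lincomb is_lebesgue_decomposition_lincomb unfolding P_def by meson
  have mono: "P h" if "mono_on {a..b} h" "left_continuous_on a b h" for h
    using ex_deriv_measure_mono[OF ab that] ex_lebesgue_decomposition_measure unfolding P_def by metis
  obtain F where F: "mono_on {a..b} F" "left_continuous_on a b F"
    "F b - F a \<le> enn2real (phi_variation \<phi> a b f)"
    "\<And>\<alpha> \<beta> \<sigma>. affine_minorant \<phi> \<alpha> \<beta> \<Longrightarrow> \<bar>\<sigma>\<bar> \<le> 1 \<Longrightarrow>
       mono_on {a..b} (\<lambda>x. F x - \<alpha> * \<sigma> * f x + \<beta> * x) \<and>
       left_continuous_on a b (\<lambda>x. F x - \<alpha> * \<sigma> * f x + \<beta> * x)"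
    using ex_var_fun_left_limit[OF ab \<phi> V lc] by blast
  obtain \<alpha> \<beta> where m: "affine_minorant \<phi> \<alpha> \<beta>" and "0 < ennreal \<alpha>"
    using ex_affine_minorant_slope[OF \<phi> growth_const_pos[OF \<phi>]] .
  then have \<alpha>: "0 < \<alpha>" by simp
  let ?G = "\<lambda>\<sigma> x. F x - \<alpha> * \<sigma> * f x + \<beta> * x"
  have PG: "P (?G \<sigma>)" if "\<bar>\<sigma>\<bar> \<le> 1" for \<sigma> using F(4)[OF m that] by (blast intro: mono)
  have "P (?G (-1))" "P (?G 0)" by (rule PG; simp)+
  from lin[OF this, of "1 / \<alpha>" "- 1 / \<alpha>"] have "P (\<lambda>x. 1 / \<alpha> * ?G (-1) x + - 1 / \<alpha> * ?G 0 x)" .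
  moreover have "(\<lambda>x. 1 / \<alpha> * ?G (-1) x + - 1 / \<alpha> * ?G 0 x) = f"
    using \<alpha> by (auto simp: fun_eq_iff field_simps)
  ultimately show ?thesis using that unfolding P_def by auto
qed

lemma total_variation_ge_finite:
  assumes \<nu>: "finite_signed_measure (borel_Icc a b) \<nu>" and fin: "finite S"
    and A: "\<And>i. i \<in> S \<Longrightarrow> A i \<in> sets (borel_Icc a b)" and disj: "disjoint_family_on A S"
  shows "(\<Sum>i\<in>S. ennreal \<bar>\<nu> (A i)\<bar>) \<le> total_variation (borel_Icc a b) \<nu> {a..b}"
proof -
  obtain p where p: "bij_betw p {0..<card S} S" using ex_bij_betw_nat_finite[OF fin] by blast
  let ?n = "card S"
  have pS: "p k \<in> S" if "k < ?n" for k using p that by (auto simp: bij_betw_def)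
  define R where "R = {a..b} - (\<Union>i\<in>S. A i)"
  define E where "E = (\<lambda>k. if k < ?n then A (p k) else if k = ?n then R else {})"
  have "R \<in> sets (borel_Icc a b)"
    using A fin unfolding R_def by (intro sets.Diff sets.finite_UN) (auto simp: sets_borel_Icc)
  then have "range E \<subseteq> sets (borel_Icc a b)" using A pS by (auto simp: E_def)
  moreover have "disjoint_family E"
    unfolding disjoint_family_on_def
  proof (intro ballI impI)
    fix k l :: nat assume "k \<noteq> l"
    have "A (p k) \<inter> A (p l) = {}" if "k < ?n" "l < ?n"
    proof -
      have "p k \<noteq> p l" using p \<open>k \<noteq> l\<close> that by (auto simp: bij_betw_def inj_on_def)
      then show ?thesis using disj pS that by (auto simp: disjoint_family_on_def)
    qed
    moreover have "A (p k) \<inter> R = {}" if "k < ?n" for k using pS[OF that] by (auto simp: R_def)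
    ultimately show "E k \<inter> E l = {}" using \<open>k \<noteq> l\<close> by (auto simp: E_def)
  qed
  moreover have "(\<Union>k. E k) = {a..b}"
  proof -
    have "(\<Union>k. E k) = (\<Union>k\<in>{0..<?n}. A (p k)) \<union> R"
      by (force simp: E_def split: if_splits)
    also have "(\<Union>k\<in>{0..<?n}. A (p k)) = (\<Union>i\<in>S. A i)"
      using p by (metis bij_betw_def image_image)
    finally show ?thesis using A by (auto simp: R_def sets_borel_Icc)
  qed
  ultimately have "(\<Sum>n. ennreal \<bar>\<nu> (E n)\<bar>) \<le> total_variation (borel_Icc a b) \<nu> {a..b}"
    unfolding total_variation_def by (intro SUP_upper) auto
  moreover have "(\<Sum>k<?n. ennreal \<bar>\<nu> (E k)\<bar>) \<le> (\<Sum>n. ennreal \<bar>\<nu> (E n)\<bar>)"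
    by (rule sum_le_suminf) auto
  moreover have "(\<Sum>i\<in>S. ennreal \<bar>\<nu> (A i)\<bar>) = (\<Sum>k<?n. ennreal \<bar>\<nu> (E k)\<bar>)"
    using p by (subst sum.reindex_bij_betw[OF p, symmetric]) (simp add: E_def lessThan_atLeast0)
  ultimately show ?thesis by simp
qed

section \<open>Upper and lower bounds\<close>

lemma ennreal_integral_le_nn_integral:
  fixes u :: "'a \<Rightarrow> real"
  assumes "integrable M u"
  shows "ennreal (integral\<^sup>L M u) \<le> (\<integral>\<^sup>+x. ennreal (u x) \<partial>M)"
proof -
  have i: "integrable M (\<lambda>x. max 0 (u x))" using assms by simp
  have "ennreal (integral\<^sup>L M u) \<le> ennreal (\<integral>x. max 0 (u x) \<partial>M)"
    using assms i by (intro ennreal_leI integral_mono) auto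
  also have "\<dots> = (\<integral>\<^sup>+x. ennreal (max 0 (u x)) \<partial>M)"
    using i by (intro nn_integral_eq_integral[symmetric]) auto
  also have "\<dots> = (\<integral>\<^sup>+x. ennreal (u x) \<partial>M)"
    by (intro nn_integral_cong) (simp add: max_def ennreal_neg)
  finally show ?thesis .
qed

lemma measurable_Phi_c_set:
  assumes "Phi_c \<phi>" "set_integrable lborel {a..b} g" "A \<in> sets (borel_Icc a b)"
  shows "(\<lambda>x. \<phi> \<bar>g x\<bar> * indicator A x) \<in> borel_measurable lborel"
proof -
  have A: "A \<in> sets borel" "A \<subseteq> {a..b}" using assms(3) by (auto simp: sets_borel_Icc)
  have "(\<lambda>x. indicator {a..b} x *\<^sub>R g x) \<in> borel_measurable lborel"
    using assms(2) by (simp add: set_integrable_def borel_measurable_integrable)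
  then have "(\<lambda>x. \<bar>indicator {a..b} x *\<^sub>R g x\<bar>) \<in> borel_measurable lborel" by measurable
  from measurable_Phi_c[OF assms(1) this]
  have "(\<lambda>x. \<phi> \<bar>indicator {a..b} x *\<^sub>R g x\<bar> * indicator A x) \<in> borel_measurable lborel"
    using A(1) by (intro borel_measurable_times_ennreal) auto
  moreover have "\<phi> \<bar>indicator {a..b} x *\<^sub>R g x\<bar> * indicator A x = \<phi> \<bar>g x\<bar> * indicator A x" for x
    using A(2) by (auto simp: indicator_def)
  ultimately show ?thesis by simp
qed

lemma phi_increment_le:
  assumes \<phi>: "Phi_c \<phi>" and \<mu>: "is_deriv_measure a b f \<mu>" and dec: "is_lebesgue_decomposition a b \<mu> g \<nu>"
    and cd: "a \<le> c" "c < d" "d \<le> b"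
  shows "\<phi> (\<bar>f c - f d\<bar> / (d - c)) * ennreal (d - c) \<le>
    (\<integral>\<^sup>+x\<in>{c..<d}. \<phi> \<bar>g x\<bar> \<partial>lborel) + growth_const \<phi> * ennreal \<bar>\<nu> {c..<d}\<bar>" (is "_ \<le> ?X")
proof -
  let ?H = "{c..<d}"
  let ?S = "{p \<in> \<rat> \<times> \<rat>. affine_minorant \<phi> (fst p) (snd p)}"
  have s: "{a..<c} \<in> sets (borel_Icc a b)" "?H \<in> sets (borel_Icc a b)" "{a..<c} \<inter> ?H = {}"
    using cd by (auto simp: sets_borel_Icc)
  have "{a..<c} \<union> ?H = {a..<d}" using cd by auto
  then have "f d - f c = \<mu> ?H"
    using finite_signed_measure_Un[OF is_deriv_measureD(1)[OF \<mu>] s]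
      is_deriv_measureD(3)[OF \<mu>, of c] is_deriv_measureD(3)[OF \<mu>, of d] cd by simp
  also have "\<dots> = (LINT x:?H|lborel. g x) + \<nu> ?H" by (rule is_lebesgue_decompositionD(3)[OF dec s(2)])
  finally have fd: "f d - f c = (LINT x:?H|lborel. g x) + \<nu> ?H" .
  have int: "set_integrable lborel ?H g"
    using is_lebesgue_decompositionD(1)[OF dec] by (rule set_integrable_subset) (use cd in auto)
  then have int': "set_integrable lborel ?H (\<lambda>x. \<bar>g x\<bar>)" by (rule set_integrable_abs)
  have "\<bar>LINT x:?H|lborel. g x\<bar> \<le> (LINT x:?H|lborel. \<bar>g x\<bar>)"
    using set_integral_norm_bound[OF int] by simp
  then have D: "\<bar>f c - f d\<bar> \<le> (LINT x:?H|lborel. \<bar>g x\<bar>) + \<bar>\<nu> ?H\<bar>" using fd by linarith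
  have "ennreal (\<alpha> * (\<bar>f c - f d\<bar> / (d - c)) - \<beta>) * ennreal (d - c) \<le> ?X"
    if m: "affine_minorant \<phi> \<alpha> \<beta>" for \<alpha> \<beta>
  proof -
    have \<alpha>: "0 \<le> \<alpha>" using m by (simp add: affine_minorant_def)
    have c: "set_integrable lborel ?H (\<lambda>x. \<beta>)"
      using cd by (auto simp: set_integrable_def intro!: integrable_real_mult_indicator integrable_mult_left)
    have i: "set_integrable lborel ?H (\<lambda>x. \<alpha> * \<bar>g x\<bar> - \<beta>)"
      by (intro set_integral_diff(1) set_integrable_mult_right int' c)
    have "(LINT x:?H|lborel. \<beta>) = \<beta> * (d - c)"
      using cd by (simp add: set_lebesgue_integral_def)
    then have eq: "(LINT x:?H|lborel. \<alpha> * \<bar>g x\<bar> - \<beta>) = \<alpha> * (LINT x:?H|lborel. \<bar>g x\<bar>) - \<beta> * (d - c)"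
      by (subst set_integral_diff(2)) (auto intro!: set_integrable_mult_right int' c)
    have "ennreal (\<alpha> * (\<bar>f c - f d\<bar> / (d - c)) - \<beta>) * ennreal (d - c) = ennreal (\<alpha> * \<bar>f c - f d\<bar> - \<beta> * (d - c))"
      using cd by (simp add: left_diff_distrib flip: ennreal_mult'')
    also have "\<dots> \<le> ennreal ((LINT x:?H|lborel. \<alpha> * \<bar>g x\<bar> - \<beta>) + \<alpha> * \<bar>\<nu> ?H\<bar>)"
      using mult_left_mono[OF D \<alpha>] unfolding eq by (intro ennreal_leI) (simp add: distrib_left)
    also have "\<dots> \<le> ennreal (LINT x:?H|lborel. \<alpha> * \<bar>g x\<bar> - \<beta>) + ennreal (\<alpha> * \<bar>\<nu> ?H\<bar>)"
      by (rule ennreal_add_le)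
    also have "\<dots> \<le> ?X"
    proof (rule add_mono)
      have "ennreal (LINT x:?H|lborel. \<alpha> * \<bar>g x\<bar> - \<beta>) \<le>
          (\<integral>\<^sup>+x. ennreal (indicator ?H x *\<^sub>R (\<alpha> * \<bar>g x\<bar> - \<beta>)) \<partial>lborel)"
        using i unfolding set_lebesgue_integral_def set_integrable_def by (rule ennreal_integral_le_nn_integral)
      also have "\<dots> \<le> (\<integral>\<^sup>+x\<in>?H. \<phi> \<bar>g x\<bar> \<partial>lborel)"
        using m by (intro nn_integral_mono) (auto simp: indicator_def affine_minorant_def)
      finally show "ennreal (LINT x:?H|lborel. \<alpha> * \<bar>g x\<bar> - \<beta>) \<le> (\<integral>\<^sup>+x\<in>?H. \<phi> \<bar>g x\<bar> \<partial>lborel)" .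
      show "ennreal (\<alpha> * \<bar>\<nu> ?H\<bar>) \<le> growth_const \<phi> * ennreal \<bar>\<nu> ?H\<bar>"
        using affine_minorant_slope_le[OF \<phi> m] \<alpha> by (simp add: ennreal_mult mult_right_mono)
    qed
    finally show ?thesis .
  qed
  then have "(SUP p\<in>?S. ennreal (fst p * (\<bar>f c - f d\<bar> / (d - c)) - snd p) * ennreal (d - c)) \<le> ?X"
    by (intro SUP_least) auto
  moreover have "\<phi> (\<bar>f c - f d\<bar> / (d - c)) =
      (SUP p\<in>?S. ennreal (fst p * (\<bar>f c - f d\<bar> / (d - c)) - snd p))"
    using cd by (intro Phi_c_eq_SUP[OF \<phi>]) simp
  ultimately show ?thesis by (simp only: SUP_mult_right_ennreal)
qed

lemma phi_variation_upper:
  assumes \<phi>: "Phi_c \<phi>" and \<mu>: "is_deriv_measure a b f \<mu>" and dec: "is_lebesgue_decomposition a b \<mu> g \<nu>"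
  shows "phi_variation \<phi> a b f \<le>
    (\<integral>\<^sup>+x\<in>{a..b}. \<phi> \<bar>g x\<bar> \<partial>lborel) + growth_const \<phi> * total_variation (borel_Icc a b) \<nu> {a..b}"
  unfolding phi_variation_def
proof (rule SUP_least)
  fix P assume P: "P \<in> partitions a b"
  then have Ps: "P \<in> subdivisions a b" using partitions_subset_subdivisions by blast
  note fin = finite_subdivisions[OF Ps]
  define H :: "real set \<Rightarrow> real set" where "H J = {Inf J..<Sup J}" for J
  have J: "\<exists>c d. J = {c..d} \<and> c < d \<and> a \<le> c \<and> d \<le> b \<and> measure lborel J = d - c \<and> Inf J = c \<and> Sup J = d"
    if "J \<in> P" for J
  proof -
    obtain c d where cd: "J = {c..d}" "c \<le> d" "a \<le> c" "d \<le> b" "measure lborel J = d - c" "Inf J = c" "Sup J = d"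
      using subdivisions_D[OF Ps \<open>J \<in> P\<close>] by metis
    have "interior J \<noteq> {}" using P that by (auto simp: partitions_def)
    then have "c < d" using cd(1) by auto
    then show ?thesis using cd by blast
  qed
  have HS: "H J \<in> sets (borel_Icc a b)" if JP: "J \<in> P" for J
    using J[OF JP] by (auto simp: H_def sets_borel_Icc)
  have disj: "disjoint_family_on H P"
    unfolding disjoint_family_on_def
  proof (intro ballI impI)
    fix J J' assume JJ: "J \<in> P" "J' \<in> P" "J \<noteq> J'"
    have int: "interior J \<inter> interior J' = {}"
      using P JJ by (auto simp: partitions_def dest: division_ofD(5))
    obtain c d where cd: "J = {c..d}" "Inf J = c" "Sup J = d" using J[OF JJ(1)] by blast
    obtain c' d' where cd': "J' = {c'..d'}" "Inf J' = c'" "Sup J' = d'" using J[OF JJ(2)] by blast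
    show "H J \<inter> H J' = {}"
    proof (rule ccontr)
      assume "H J \<inter> H J' \<noteq> {}"
      then have "max c c' < min d d'" using cd cd' by (auto simp: H_def)
      then obtain z where "max c c' < z" "z < min d d'" using dense by blast
      then have "z \<in> interior J \<inter> interior J'" using cd cd' by simp
      then show False using int by simp
    qed
  qed
  have "(\<Sum>J\<in>P. \<phi> (\<bar>f (Inf J) - f (Sup J)\<bar> / measure lborel J) * ennreal (measure lborel J)) \<le>
      (\<Sum>J\<in>P. (\<integral>\<^sup>+x\<in>H J. \<phi> \<bar>g x\<bar> \<partial>lborel) + growth_const \<phi> * ennreal \<bar>\<nu> (H J)\<bar>)"
  proof (rule sum_mono)
    fix J assume "J \<in> P"
    from J[OF this] obtain c d where "c < d" "a \<le> c" "d \<le> b" "measure lborel J = d - c" "Inf J = c" "Sup J = d"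
      by blast
    then show "\<phi> (\<bar>f (Inf J) - f (Sup J)\<bar> / measure lborel J) * ennreal (measure lborel J) \<le>
        (\<integral>\<^sup>+x\<in>H J. \<phi> \<bar>g x\<bar> \<partial>lborel) + growth_const \<phi> * ennreal \<bar>\<nu> (H J)\<bar>"
      using phi_increment_le[OF \<phi> \<mu> dec, of c d] by (simp add: H_def)
  qed
  also have "\<dots> = (\<Sum>J\<in>P. \<integral>\<^sup>+x\<in>H J. \<phi> \<bar>g x\<bar> \<partial>lborel) + growth_const \<phi> * (\<Sum>J\<in>P. ennreal \<bar>\<nu> (H J)\<bar>)"
    by (simp only: sum.distrib sum_distrib_left)
  also have "(\<Sum>J\<in>P. \<integral>\<^sup>+x\<in>H J. \<phi> \<bar>g x\<bar> \<partial>lborel) = (\<integral>\<^sup>+x. (\<Sum>J\<in>P. \<phi> \<bar>g x\<bar> * indicator (H J) x) \<partial>lborel)"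
    by (intro nn_integral_sum[symmetric] measurable_Phi_c_set[OF \<phi> is_lebesgue_decompositionD(1)[OF dec] HS])
  also have "\<dots> \<le> (\<integral>\<^sup>+x\<in>{a..b}. \<phi> \<bar>g x\<bar> \<partial>lborel)"
  proof (rule nn_integral_mono)
    fix x
    have "(\<Sum>J\<in>P. indicator (H J) x :: ennreal) = indicator (\<Union>J\<in>P. H J) x"
      by (rule indicator_UN_disjoint[OF fin disj, symmetric])
    also have "\<dots> \<le> indicator {a..b} x"
    proof (rule indicator_leI)
      show "x \<in> {a..b}" if "x \<in> (\<Union>J\<in>P. H J)" using that HS unfolding sets_borel_Icc by blast
    qed
    finally show "(\<Sum>J\<in>P. \<phi> \<bar>g x\<bar> * indicator (H J) x) \<le> \<phi> \<bar>g x\<bar> * indicator {a..b} x"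
      unfolding sum_distrib_left[symmetric] by (rule mult_left_mono) simp
  qed
  also have "(\<Sum>J\<in>P. ennreal \<bar>\<nu> (H J)\<bar>) \<le> total_variation (borel_Icc a b) \<nu> {a..b}"
    by (rule total_variation_ge_finite[OF is_lebesgue_decompositionD(2)[OF dec] fin HS disj])
  finally show "(\<Sum>J\<in>P. \<phi> (\<bar>f (Inf J) - f (Sup J)\<bar> / measure lborel J) * ennreal (measure lborel J)) \<le>
      (\<integral>\<^sup>+x\<in>{a..b}. \<phi> \<bar>g x\<bar> \<partial>lborel) + growth_const \<phi> * total_variation (borel_Icc a b) \<nu> {a..b}"
    by (simp add: add_mono mult_left_mono)
qed

lemma phi_variation_lower:
  assumes ab: "a < b" and \<phi>: "Phi_c \<phi>" and V: "phi_variation \<phi> a b f < \<infinity>"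
    and lc: "left_continuous_on a b f" and \<mu>: "is_deriv_measure a b f \<mu>"
    and dec: "is_lebesgue_decomposition a b \<mu> g \<nu>"
  shows "(\<integral>\<^sup>+x\<in>{a..b}. \<phi> \<bar>g x\<bar> \<partial>lborel) + growth_const \<phi> * total_variation (borel_Icc a b) \<nu> {a..b}
    \<le> phi_variation \<phi> a b f"
proof -
  let ?I = "{a..b}"
  obtain L where L: "sets L = sets borel" "emeasure L ?I < \<infinity>" "emeasure L ?I \<le> phi_variation \<phi> a b f"
    "\<And>\<alpha> \<beta> \<sigma> A. affine_minorant \<phi> \<alpha> \<beta> \<Longrightarrow> \<bar>\<sigma>\<bar> \<le> 1 \<Longrightarrow> A \<in> sets (borel_Icc a b) \<Longrightarrow>
       \<alpha> * \<sigma> * \<mu> A - \<beta> * measure lborel A \<le> measure L A"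
    using ex_dominating_measure[OF ab \<phi> V lc \<mu>] by blast
  obtain r N\<^sub>L where r: "N\<^sub>L \<in> null_sets lborel" "N\<^sub>L \<subseteq> ?I" "r \<in> borel_measurable borel" "\<And>x. 0 \<le> r x"
    "is_lebesgue_decomposition a b (measure L) r (\<lambda>A. measure L (A \<inter> N\<^sub>L))"
    using ex_lebesgue_decomposition_measure[OF L(1,2)] by metis
  obtain N\<^sub>\<nu> where N\<^sub>\<nu>: "N\<^sub>\<nu> \<in> null_sets lborel" "N\<^sub>\<nu> \<subseteq> ?I"
    "\<And>A. A \<in> sets (borel_Icc a b) \<Longrightarrow> A \<inter> N\<^sub>\<nu> = {} \<Longrightarrow> \<nu> A = 0"
    using is_lebesgue_decomposition_nullE[OF dec] by blast
  define N where "N = N\<^sub>L \<union> N\<^sub>\<nu>"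
  have Nn: "N \<in> null_sets lborel" using r(1) N\<^sub>\<nu>(1) unfolding N_def by (rule null_sets.Un)
  have Ns: "N \<in> sets (borel_Icc a b)"
    using null_setsD2[OF Nn] r(2) N\<^sub>\<nu>(2) by (simp add: sets_borel_Icc N_def)
  have ri: "set_integrable lborel ?I r" by (rule is_lebesgue_decompositionD(1)[OF r(5)])
  have gi: "set_integrable lborel ?I g" by (rule is_lebesgue_decompositionD(1)[OF dec])
  have fA: "emeasure L A = ennreal (measure L A)" if "A \<subseteq> ?I" for A
  proof (rule emeasure_eq_ennreal_measure)
    have "emeasure L A \<le> emeasure L ?I" using that L(1) by (intro emeasure_mono) auto
    then show "emeasure L A \<noteq> top" using L(2) by (auto simp: top_unique)
  qed
  have regular: "measure L A = (LINT x:A|lborel. r x)" "\<mu> A = (LINT x:A|lborel. g x)"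
    if "A \<in> sets (borel_Icc a b)" "A \<inter> N = {}" for A
  proof -
    have "A \<inter> N\<^sub>L = {}" "A \<inter> N\<^sub>\<nu> = {}" using that(2) by (auto simp: N_def)
    then show "measure L A = (LINT x:A|lborel. r x)" "\<mu> A = (LINT x:A|lborel. g x)"
      using is_lebesgue_decompositionD(3)[OF r(5) that(1)] is_lebesgue_decompositionD(3)[OF dec that(1)]
        N\<^sub>\<nu>(3)[OF that(1)] by simp_all
  qed
  have density: "AE x in lborel. x \<in> ?I \<longrightarrow> \<alpha> * \<sigma> * g x - \<beta> \<le> r x"
    if m: "affine_minorant \<phi> \<alpha> \<beta>" "\<bar>\<sigma>\<bar> \<le> 1" for \<alpha> \<beta> \<sigma>
  proof -
    define h where "h = (\<lambda>x. indicator ?I x *\<^sub>R (\<alpha> * \<sigma> * g x - \<beta> - r x))"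
    have ci: "set_integrable lborel ?I (\<lambda>x. \<beta>)"
      using ab by (auto simp: set_integrable_def intro!: integrable_real_mult_indicator integrable_mult_left)
    have "set_integrable lborel ?I (\<lambda>x. \<alpha> * \<sigma> * g x - \<beta> - r x)"
      by (intro set_integral_diff(1) set_integrable_mult_right gi ci ri)
    then have hi: "integrable lborel h" by (simp add: h_def set_integrable_def)
    then have hm[measurable]: "h \<in> borel_measurable borel" by (simp add: borel_measurable_integrable)
    define A where "A = {x. 0 < h x} - N"
    have "{x. 0 < h x} \<in> sets borel" by measurable
    moreover have "{x. 0 < h x} \<subseteq> ?I" by (auto simp: h_def indicator_def split: if_splits)
    ultimately have A: "A \<in> sets (borel_Icc a b)" "A \<inter> N = {}"
      using Ns by (auto simp: A_def sets_borel_Icc)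
    have As: "A \<in> sets borel" "A \<subseteq> ?I" using A(1) by (auto simp: sets_borel_Icc)
    have sub: "set_integrable lborel A g" "set_integrable lborel A r" "set_integrable lborel A (\<lambda>x. \<beta>)"
      using As gi ri ci by (auto intro: set_integrable_subset)
    have "emeasure lborel A < \<infinity>"
      using emeasure_mono[of A ?I lborel] As by (auto simp: emeasure_lborel_Icc_eq le_less_trans)
    then have "(LINT x:A|lborel. \<beta>) = \<beta> * measure lborel A"
      using As by (simp add: set_lebesgue_integral_def)
    then have "(LINT x:A|lborel. \<alpha> * \<sigma> * g x - \<beta> - r x) = \<alpha> * \<sigma> * \<mu> A - \<beta> * measure lborel A - measure L A"
      using sub by (simp add: set_integral_diff set_integrable_mult_right regular[OF A])
    also have "\<dots> \<le> 0" using L(4)[OF m A(1)] by simp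
    finally have "(LINT x|lborel. indicator A x * h x) \<le> 0"
      unfolding set_lebesgue_integral_def
      by (rule order_trans[rotated]) (intro eq_refl Bochner_Integration.integral_cong, use As in \<open>auto simp: h_def indicator_def\<close>)
    moreover have hA: "0 \<le> indicator A x * h x" for x by (auto simp: A_def indicator_def)
    then have "0 \<le> (LINT x|lborel. indicator A x * h x)" by (intro integral_nonneg_AE) simp
    ultimately have "(LINT x|lborel. indicator A x * h x) = 0" by simp
    moreover have "integrable lborel (\<lambda>x. indicator A x * h x)"
      using integrable_mult_indicator[OF _ hi, of A] As by simp
    ultimately have "AE x in lborel. indicator A x * h x = 0"
      using hA by (subst (asm) integral_nonneg_eq_0_iff_AE) auto
    then have "AE x in lborel. \<not> 0 < h x"
      using AE_not_in[OF Nn] by eventually_elim (auto simp: A_def indicator_def split: if_splits)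
    then show ?thesis by eventually_elim (auto simp: h_def)
  qed
  let ?S = "{p \<in> \<rat> \<times> \<rat>. affine_minorant \<phi> (fst p) (snd p)}"
  have cS: "countable ?S"
    by (rule countable_subset[of _ "\<rat> \<times> \<rat>"]) (auto intro: countable_SIGMA countable_rat)
  have "AE x in lborel. x \<in> ?I \<longrightarrow> fst p * \<bar>g x\<bar> - snd p \<le> r x" if "p \<in> ?S" for p
  proof -
    have m: "affine_minorant \<phi> (fst p) (snd p)" using that by simp
    show ?thesis
      using density[OF m, of 1, simplified] density[OF m, of "-1", simplified]
      by eventually_elim (auto simp: abs_if)
  qed
  then have "AE x in lborel. \<forall>p\<in>?S. x \<in> ?I \<longrightarrow> fst p * \<bar>g x\<bar> - snd p \<le> r x"
    unfolding AE_ball_countable[OF cS] by (rule ballI)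
  then have "AE x in lborel. \<phi> \<bar>g x\<bar> * indicator ?I x \<le> ennreal (indicator ?I x *\<^sub>R r x)"
  proof eventually_elim
    case (elim x)
    have "(SUP p\<in>?S. ennreal (fst p * \<bar>g x\<bar> - snd p)) \<le> ennreal (r x)" if "x \<in> ?I"
      using elim that by (intro SUP_least ennreal_leI) blast
    then show ?case using Phi_c_eq_SUP[OF \<phi>, of "\<bar>g x\<bar>"] by (auto simp: indicator_def)
  qed
  then have "(\<integral>\<^sup>+x\<in>?I. \<phi> \<bar>g x\<bar> \<partial>lborel) \<le> (\<integral>\<^sup>+x. ennreal (indicator ?I x *\<^sub>R r x) \<partial>lborel)"
    by (rule nn_integral_mono_AE)
  also have "\<dots> = ennreal (LINT x:?I|lborel. r x)"
    unfolding set_lebesgue_integral_def using ri r(4)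
    by (intro nn_integral_eq_integral) (auto simp: set_integrable_def)
  also have "(LINT x:?I|lborel. r x) = (LINT x:?I - N|lborel. r x)"
    unfolding set_lebesgue_integral_def
  proof (rule integral_cong_AE)
    show "(\<lambda>x. indicator ?I x *\<^sub>R r x) \<in> borel_measurable lborel"
      "(\<lambda>x. indicator (?I - N) x *\<^sub>R r x) \<in> borel_measurable lborel"
      using r(3) Ns by (auto simp: sets_borel_Icc)
    show "AE x in lborel. indicator ?I x *\<^sub>R r x = indicator (?I - N) x *\<^sub>R r x"
      using AE_not_in[OF Nn] by eventually_elim (auto simp: indicator_def)
  qed
  also have "ennreal \<dots> = emeasure L (?I - N)"
  proof -
    have "?I - N \<in> sets (borel_Icc a b)" "(?I - N) \<inter> N = {}" "?I - N \<subseteq> ?I"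
      using Ns by (auto simp: sets_borel_Icc)
    then show ?thesis using regular(1)[of "?I - N"] fA[of "?I - N"] by simp
  qed
  finally have ac: "(\<integral>\<^sup>+x\<in>?I. \<phi> \<bar>g x\<bar> \<partial>lborel) \<le> emeasure L (?I - N)" .
  have "growth_const \<phi> * total_variation (borel_Icc a b) \<nu> ?I \<le> emeasure L N"
  proof (rule growth_const_mult_le[OF \<phi>])
    fix \<alpha> \<beta> assume m: "affine_minorant \<phi> \<alpha> \<beta>"
    show "ennreal \<alpha> * total_variation (borel_Icc a b) \<nu> ?I \<le> emeasure L N"
      unfolding total_variation_def SUP_mult_left_ennreal
    proof (rule SUP_least)
      fix E :: "nat \<Rightarrow> real set"
      assume "E \<in> {E. range E \<subseteq> sets (borel_Icc a b) \<and> disjoint_family E \<and> (\<Union>n. E n) = ?I}"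
      then have E: "\<And>n. E n \<in> sets (borel_Icc a b)" "disjoint_family E" by auto
      have le: "ennreal \<alpha> * ennreal \<bar>\<nu> (E n)\<bar> \<le> emeasure L (E n \<inter> N)" for n
      proof -
        let ?B = "E n \<inter> N"
        have B: "?B \<in> sets (borel_Icc a b)" "E n - N \<in> sets (borel_Icc a b)"
          using E(1) Ns by (auto simp: sets_borel_Icc)
        have Bn: "?B \<in> null_sets lborel" using Nn E(1)[of n] by (intro null_set_Int1) (auto simp: sets_borel_Icc)
        have "\<nu> (?B \<union> (E n - N)) = \<nu> ?B + \<nu> (E n - N)"
          by (rule finite_signed_measure_Un[OF is_lebesgue_decompositionD(2)[OF dec] B]) auto
        moreover have "?B \<union> (E n - N) = E n" by auto
        moreover have "\<nu> (E n - N) = 0" by (rule N\<^sub>\<nu>(3)[OF B(2)]) (auto simp: N_def)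
        ultimately have "\<nu> (E n) = \<nu> ?B" by simp
        also have "\<dots> = \<mu> ?B"
          using is_lebesgue_decompositionD(3)[OF dec B(1)] set_integral_null_set[OF Bn] by simp
        finally have eq: "\<nu> (E n) = \<mu> ?B" .
        have "measure lborel ?B = 0" using Bn by (simp add: measure_eq_0_null_sets)
        then have "\<alpha> * sgn (\<mu> ?B) * \<mu> ?B \<le> measure L ?B"
          using L(4)[OF m _ B(1), of "sgn (\<mu> ?B)"] by (simp add: sgn_if)
        moreover have "sgn (\<mu> ?B) * \<mu> ?B = \<bar>\<mu> ?B\<bar>" by (simp add: sgn_if)
        ultimately have "\<alpha> * \<bar>\<nu> (E n)\<bar> \<le> measure L ?B" unfolding eq by (simp add: mult.assoc)
        moreover have "?B \<subseteq> ?I" using B(1) by (simp add: sets_borel_Icc)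
        ultimately show ?thesis
          using m fA[of ?B] by (simp add: affine_minorant_def ennreal_leI flip: ennreal_mult)
      qed
      have "ennreal \<alpha> * (\<Sum>n. ennreal \<bar>\<nu> (E n)\<bar>) = (\<Sum>n. ennreal \<alpha> * ennreal \<bar>\<nu> (E n)\<bar>)" by simp
      also have "\<dots> \<le> (\<Sum>n. emeasure L (E n \<inter> N))" by (intro suminf_le le) auto
      also have "\<dots> = emeasure L (\<Union>n. E n \<inter> N)"
      proof (rule suminf_emeasure)
        show "range (\<lambda>n. E n \<inter> N) \<subseteq> sets L" using E(1) Ns L(1) by (auto simp: sets_borel_Icc)
        show "disjoint_family (\<lambda>n. E n \<inter> N)" using E(2) by (rule disjoint_family_on_bisimulation) auto
      qed
      also have "\<dots> \<le> emeasure L N" using Ns L(1) by (intro emeasure_mono) (auto simp: sets_borel_Icc)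
      finally show "ennreal \<alpha> * (\<Sum>n. ennreal \<bar>\<nu> (E n)\<bar>) \<le> emeasure L N" .
    qed
  qed
  with ac have "(\<integral>\<^sup>+x\<in>?I. \<phi> \<bar>g x\<bar> \<partial>lborel) + growth_const \<phi> * total_variation (borel_Icc a b) \<nu> ?I
      \<le> emeasure L (?I - N) + emeasure L N" by (rule add_mono)
  also have "\<dots> = emeasure L ((?I - N) \<union> N)"
    using Ns L(1) by (intro plus_emeasure) (auto simp: sets_borel_Icc)
  also have "(?I - N) \<union> N = ?I" using Ns by (auto simp: sets_borel_Icc)
  finally show ?thesis using L(3) by simp
qed

lemma ac_density_singular_part:
  assumes "is_deriv_measure a b f \<mu>" "is_lebesgue_decomposition a b \<mu> g \<nu>" "a < b"
  shows "is_deriv_measure a b f (deriv_measure a b f)"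
    "is_lebesgue_decomposition a b (deriv_measure a b f) (ac_density a b f) (singular_part a b f)"
proof -
  let ?\<mu> = "deriv_measure a b f" and ?g = "ac_density a b f" and ?\<nu> = "singular_part a b f"
  show D: "is_deriv_measure a b f ?\<mu>"
    unfolding deriv_measure_def by (rule someI[of "is_deriv_measure a b f", OF assms(1)])
  have "\<mu> A = ?\<mu> A" if "A \<in> sets (borel_Icc a b)" for A
    using is_deriv_measure_unique[OF _ assms(1) D that] assms(3) by simp
  then have dec: "is_lebesgue_decomposition a b ?\<mu> g \<nu>"
    using is_lebesgue_decomposition_cong[OF assms(2)] by blast
  then have "\<exists>\<nu>. is_lebesgue_decomposition a b ?\<mu> ?g \<nu>"
    unfolding ac_density_def by (intro someI_ex[of "\<lambda>g. \<exists>\<nu>. is_lebesgue_decomposition a b ?\<mu> g \<nu>"]) blast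
  then obtain \<nu>' where 1: "is_lebesgue_decomposition a b ?\<mu> ?g \<nu>'" by blast
  have "\<exists>g. is_lebesgue_decomposition a b ?\<mu> g ?\<nu>"
    unfolding singular_part_def using dec
    by (intro someI_ex[of "\<lambda>\<nu>. \<exists>g. is_lebesgue_decomposition a b ?\<mu> g \<nu>"]) blast
  then obtain g' where 2: "is_lebesgue_decomposition a b ?\<mu> g' ?\<nu>" by blast
  have "\<nu>' A = ?\<nu> A" if "A \<in> sets (borel_Icc a b)" for A
    by (rule singular_part_unique[OF 1 2 that])
  then show "is_lebesgue_decomposition a b ?\<mu> ?g ?\<nu>"
    using 1 is_lebesgue_decompositionD(2)[OF 2] unfolding is_lebesgue_decomposition_def by simp
qed

lemma phi_variation_eq:
  assumes ab: "a < b" and \<phi>: "Phi_c \<phi>" and V: "phi_variation \<phi> a b f < \<infinity>"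
    and lc: "left_continuous_on a b f"
  shows "phi_variation \<phi> a b f = (\<integral>\<^sup>+x\<in>{a..b}. \<phi> \<bar>ac_density a b f x\<bar> \<partial>lborel) +
      growth_const \<phi> * total_variation (borel_Icc a b) (singular_part a b f) {a..b}"
proof -
  obtain \<mu> g \<nu> where "is_deriv_measure a b f \<mu>" "is_lebesgue_decomposition a b \<mu> g \<nu>"
    using ex_decomposed_deriv_measure[OF ab \<phi> V lc] by blast
  note D = ac_density_singular_part[OF this ab]
  show ?thesis
    by (rule antisym[OF phi_variation_upper[OF \<phi> D] phi_variation_lower[OF ab \<phi> V lc D]])
qed

theorem corollary1p4:
  fixes a b :: real and \<phi> :: "real \<Rightarrow> ennreal" and f :: "real \<Rightarrow> real"
  assumes "a < b"
    and "Phi_c \<phi>"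
    and "phi_variation \<phi> a b f < \<infinity>"
  shows "(growth_const \<phi> < \<infinity> \<and> left_continuous_on a b f \<longrightarrow>
            bounded_variation_on a b f \<and>
            phi_variation \<phi> a b f =
              (\<integral>\<^sup>+x\<in>{a..b}. \<phi> \<bar>ac_density a b f x\<bar> \<partial>lborel) +
              growth_const \<phi> * total_variation (borel_Icc a b) (singular_part a b f) {a..b})
       \<and> (growth_const \<phi> = \<infinity> \<longrightarrow>
            absolutely_continuous_on a b f \<and>
            phi_variation \<phi> a b f = (\<integral>\<^sup>+x\<in>{a..b}. \<phi> \<bar>ac_density a b f x\<bar> \<partial>lborel))"
proof (intro conjI impI)
  assume "growth_const \<phi> < \<infinity> \<and> left_continuous_on a b f"
  then show "bounded_variation_on a b f" "phi_variation \<phi> a b f =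
      (\<integral>\<^sup>+x\<in>{a..b}. \<phi> \<bar>ac_density a b f x\<bar> \<partial>lborel) +
      growth_const \<phi> * total_variation (borel_Icc a b) (singular_part a b f) {a..b}"
    using bounded_variation_if_finite[OF assms] phi_variation_eq[OF assms] by blast+
next
  let ?T = "total_variation (borel_Icc a b) (singular_part a b f) {a..b}"
  assume K: "growth_const \<phi> = \<infinity>"
  show ac: "absolutely_continuous_on a b f" by (rule absolutely_continuous_if_finite[OF assms K])
  have eq: "phi_variation \<phi> a b f = (\<integral>\<^sup>+x\<in>{a..b}. \<phi> \<bar>ac_density a b f x\<bar> \<partial>lborel) + \<infinity> * ?T"
    using phi_variation_eq[OF assms left_continuous_if_absolutely_continuous[OF ac]] K by simp
  then have "\<infinity> * ?T < \<infinity>" using assms(3) by (metis add.commute ennreal_add_eq_top infinity_ennreal_def top.not_eq_extremum)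
  then have "?T = 0" by (auto simp: ennreal_top_mult split: if_splits)
  then show "phi_variation \<phi> a b f = (\<integral>\<^sup>+x\<in>{a..b}. \<phi> \<bar>ac_density a b f x\<bar> \<partial>lborel)"
    using eq by simp
qed

end
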